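(* Let $(z,\zeta)$ be the standard linear coordinates on $\mathbb{C}^{1|1}$, and let $\mathbb{C}^{1|1}$ have the SUSY-1 structure $\mathcal{D}$ spanned by the odd vector field $V=\partial_\zeta+\zeta\partial_z$. The SUSY automorphisms of $\mathbb{C}^{1|1}$ are precisely the endomorphisms $F$ of the supermanifold $\mathbb{C}^{1|1}$ of the form $$F(z,\zeta)=(az+b,\ \pm\sqrt{a}\,\zeta),$$ where $a\in\mathbb{C}^*$, $b\in\mathbb{C}$, and $\sqrt{a}$ denotes either of the two square roots of $a$.
   Context: $\mathbb{C}^{1|1}$ is the complex supermanifold with underlying space $\mathbb{C}$ and structure sheaf $U\mapsto\mathrm{Hol}(U)\otimes\wedge(\zeta)$, with $z$ even and $\zeta$ odd. The notation $F(z,\zeta)=(w,\eta)$ means $F^*(z)=w$, $F^*(\zeta)=\eta$. A SUSY-1 structure on a $1|1$-dimensional complex supermanifold $X$ is a locally direct rank $0|1$ subsheaf $\mathcal{D}\subset TX$ such that $\mathcal{D}\otimes\mathcal{D}\to TX/\mathcal{D}$, $Y\otimes Z\mapsto[Y,Z]\ (\mathrm{mod}\ \mathcal{D})$ (super Lie bracket) is an isomorphism of sheaves. A SUSY automorphism of $(X,\mathcal{D})$ is an automorphism $F$ of the supermanifold $X$ such that $dF$ carries the stalk of $\mathcal{D}$ at $p$ onto the stalk of $\mathcal{D}$ at $|F|(p)$ for every $p\in|X|$. *)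

theory Defs
  imports "HOL-Complex_Analysis.Complex_Analysis" "HOL-Library.Function_Algebras"
begin

text \<open>The Grassmann algebra \<open>\<wedge>(\<zeta>)\<close> over the complex numbers: \<open>Grass a b\<close> is \<open>a + b \<zeta>\<close>.
  With a single odd generator it is commutative in the ungraded sense as well.\<close>

datatype grassmann = Grass (body: complex) (soul: complex)

instantiation grassmann :: comm_ring_1
begin

definition zero_grassmann where "0 = Grass 0 0"
definition one_grassmann where "1 = Grass 1 0"
definition plus_grassmann where "a + b = Grass (body a + body b) (soul a + soul b)"
definition uminus_grassmann where "- a = Grass (- body a) (- soul a)"
definition minus_grassmann where "a - b = Grass (body a - body b) (soul a - soul b)"
definition times_grassmann
  where "a * b = Grass (body a * body b) (body a * soul b + soul a * body b)"

instance
  by standard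
    (auto simp: zero_grassmann_def one_grassmann_def plus_grassmann_def uminus_grassmann_def
        minus_grassmann_def times_grassmann_def algebra_simps intro: grassmann.expand)

end

text \<open>A section of the structure sheaf of \<open>\<complex>\<^bsup>1|1\<^esup>\<close> over an open set \<open>U\<close> is represented by a
  function on all of the plane that vanishes off \<open>U\<close>.  The same convention (value zero outside
  the proper domain) is used for vector fields and for the pull-backs of morphisms, so that
  equality in HOL is equality of the represented objects; the ring operations on functions are
  the pointwise ones.\<close>

type_synonym superfun = "complex \<Rightarrow> grassmann"

definition sections :: "complex set \<Rightarrow> superfun set"
  where "sections U = {s. (\<lambda>x. body (s x)) holomorphic_on U \<and> (\<lambda>x. soul (s x)) holomorphic_on U
                          \<and> (\<forall>x. x \<notin> U \<longrightarrow> s x = 0)}"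

definition restr :: "complex set \<Rightarrow> superfun \<Rightarrow> superfun"
  where "restr V s = (\<lambda>x. if x \<in> V then s x else 0)"

definition cst :: "complex \<Rightarrow> superfun"
  where "cst c = (\<lambda>x. Grass c 0)"

definition z_coord :: superfun
  where "z_coord = (\<lambda>x. Grass x 0)"

definition zeta_coord :: superfun
  where "zeta_coord = (\<lambda>x. Grass 0 1)"

text \<open>Parities are natural numbers, read modulo 2.\<close>

definition gpart :: "nat \<Rightarrow> superfun \<Rightarrow> superfun"
  where "gpart j s = (\<lambda>x. if even j then Grass (body (s x)) 0 else Grass 0 (soul (s x)))"

definition homogeneous :: "nat \<Rightarrow> superfun \<Rightarrow> bool"
  where "homogeneous j s \<longleftrightarrow> gpart j s = s"


subsection \<open>Morphisms\<close>

record super_map =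
  base :: "complex \<Rightarrow> complex"
  pull :: "complex set \<Rightarrow> superfun \<Rightarrow> superfun"

text \<open>The last clause is locality: the maximal ideal of the stalk at \<open>p\<close> consists of the germs
  of the sections whose body vanishes at \<open>p\<close>.\<close>

definition super_morphism :: "super_map \<Rightarrow> bool"
  where "super_morphism F \<longleftrightarrow>
    continuous_on UNIV (base F) \<and>
    (\<forall>U s. \<not> (open U \<and> s \<in> sections U) \<longrightarrow> pull F U s = 0) \<and>
    (\<forall>U. open U \<longrightarrow>
      (\<forall>s\<in>sections U. pull F U s \<in> sections (base F -` U)) \<and>
      pull F U (restr U 1) = restr (base F -` U) 1 \<and>
      (\<forall>s\<in>sections U. \<forall>t\<in>sections U. pull F U (s + t) = pull F U s + pull F U t) \<and>
      (\<forall>s\<in>sections U. \<forall>t\<in>sections U. pull F U (s * t) = pull F U s * pull F U t) \<and>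
      (\<forall>c. \<forall>s\<in>sections U. pull F U (cst c * s) = cst c * pull F U s) \<and>
      (\<forall>j. \<forall>s\<in>sections U. homogeneous j s \<longrightarrow> homogeneous j (pull F U s)) \<and>
      (\<forall>V. open V \<longrightarrow> V \<subseteq> U \<longrightarrow>
        (\<forall>s\<in>sections U. pull F V (restr V s) = restr (base F -` V) (pull F U s))) \<and>
      (\<forall>s\<in>sections U. \<forall>p. base F p \<in> U \<longrightarrow> body (s (base F p)) = 0 \<longrightarrow> body (pull F U s p) = 0))"

definition super_id :: super_map
  where "super_id = \<lparr>base = id, pull = (\<lambda>U s. if open U \<and> s \<in> sections U then s else 0)\<rparr>"

definition super_comp :: "super_map \<Rightarrow> super_map \<Rightarrow> super_map"
  where "super_comp G F = \<lparr>base = base G \<circ> base F,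
                           pull = (\<lambda>U s. pull F (base G -` U) (pull G U s))\<rparr>"

definition inverse_of :: "super_map \<Rightarrow> super_map \<Rightarrow> bool"
  where "inverse_of F G \<longleftrightarrow> super_morphism G \<and> super_comp G F = super_id \<and> super_comp F G = super_id"

definition super_automorphism :: "super_map \<Rightarrow> bool"
  where "super_automorphism F \<longleftrightarrow> super_morphism F \<and> (\<exists>G. inverse_of F G)"

definition super_inv :: "super_map \<Rightarrow> super_map"
  where "super_inv F = (THE G. inverse_of F G)"

text \<open>\<open>has_coords F w \<eta>\<close> is the notation \<open>F(z, \<zeta>) = (w, \<eta>)\<close>; such an \<open>F\<close> exists and is unique
  for all global even \<open>w\<close> and odd \<open>\<eta>\<close>, see \<open>ex1_super_morphism\<close>.\<close>

definition has_coords :: "super_map \<Rightarrow> superfun \<Rightarrow> superfun \<Rightarrow> bool"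
  where "has_coords F w \<eta> \<longleftrightarrow> pull F UNIV z_coord = w \<and> pull F UNIV zeta_coord = \<eta>"


subsection \<open>Vector fields\<close>

text \<open>A vector field over \<open>U\<close> is a superderivation of the structure sheaf restricted to \<open>U\<close>, that
  is, a family indexed by the open subsets of \<open>U\<close>.\<close>

type_synonym vfield = "complex set \<Rightarrow> superfun \<Rightarrow> superfun"

definition linear_endo :: "complex set \<Rightarrow> vfield \<Rightarrow> bool"
  where "linear_endo U Y \<longleftrightarrow>
    (\<forall>W s. \<not> (open W \<and> W \<subseteq> U \<and> s \<in> sections W) \<longrightarrow> Y W s = 0) \<and>
    (\<forall>W. open W \<longrightarrow> W \<subseteq> U \<longrightarrow>
      (\<forall>s\<in>sections W. Y W s \<in> sections W) \<and>
      (\<forall>s\<in>sections W. \<forall>t\<in>sections W. Y W (s + t) = Y W s + Y W t) \<and>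
      (\<forall>c. \<forall>s\<in>sections W. Y W (cst c * s) = cst c * Y W s) \<and>
      (\<forall>W'. open W' \<longrightarrow> W' \<subseteq> W \<longrightarrow> (\<forall>s\<in>sections W. Y W' (restr W' s) = restr W' (Y W s))))"

definition superderivation :: "complex set \<Rightarrow> nat \<Rightarrow> vfield \<Rightarrow> bool"
  where "superderivation U i Y \<longleftrightarrow> linear_endo U Y \<and>
    (\<forall>W j. open W \<longrightarrow> W \<subseteq> U \<longrightarrow> (\<forall>s\<in>sections W. homogeneous j s \<longrightarrow>
      homogeneous (i + j) (Y W s) \<and>
      (\<forall>t\<in>sections W. Y W (s * t) = Y W s * t + (-1) ^ (i * j) * (s * Y W t))))"

definition TX :: "complex set \<Rightarrow> vfield set"
  where "TX U = {Y + Z | Y Z. superderivation U 0 Y \<and> superderivation U 1 Z}"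

definition vrestr :: "complex set \<Rightarrow> vfield \<Rightarrow> vfield"
  where "vrestr V Y = (\<lambda>W s. if W \<subseteq> V then Y W s else 0)"

definition smul :: "superfun \<Rightarrow> vfield \<Rightarrow> vfield"
  where "smul t Y = (\<lambda>W s. restr W t * Y W s)"

definition d_z :: "complex set \<Rightarrow> vfield"
  where "d_z U = (\<lambda>W s. if open W \<and> W \<subseteq> U \<and> s \<in> sections W
      then restr W (\<lambda>x. Grass (deriv (\<lambda>x. body (s x)) x) (deriv (\<lambda>x. soul (s x)) x)) else 0)"

definition d_zeta :: "complex set \<Rightarrow> vfield"
  where "d_zeta U = (\<lambda>W s. if open W \<and> W \<subseteq> U \<and> s \<in> sections W
      then (\<lambda>x. Grass (soul (s x)) 0) else 0)"

definition germ :: "complex \<Rightarrow> complex set \<times> vfield \<Rightarrow> (complex set \<times> vfield) set"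
  where "germ p = (\<lambda>(U, Y). {(U', Y'). open U' \<and> p \<in> U' \<and> Y' \<in> TX U' \<and>
      (\<exists>W. open W \<and> p \<in> W \<and> W \<subseteq> U \<inter> U' \<and> vrestr W Y = vrestr W Y')})"

definition stalk :: "(complex set \<Rightarrow> vfield set) \<Rightarrow> complex \<Rightarrow> (complex set \<times> vfield) set set"
  where "stalk D p = {germ p (U, Y) | U Y. open U \<and> p \<in> U \<and> Y \<in> D U}"

text \<open>For an automorphism \<open>F\<close>, \<open>dF(Y) = (F\<^sup>-\<^sup>1)\<^sup>* \<circ> Y \<circ> F\<^sup>*\<close>.  The union
  in \<open>germ_push\<close> ranges over the representatives of a germ and has only one distinct member.\<close>

definition push :: "super_map \<Rightarrow> vfield \<Rightarrow> vfield"
  where "push F Y = (\<lambda>W s. pull (super_inv F) (base F -` W) (Y (base F -` W) (pull F W s)))"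

definition germ_push ::
    "super_map \<Rightarrow> complex \<Rightarrow> (complex set \<times> vfield) set \<Rightarrow> (complex set \<times> vfield) set"
  where "germ_push F p \<gamma> = (\<Union>(U, Y)\<in>\<gamma>. germ (base F p) (base F ` U, push F Y))"

definition susy_automorphism :: "(complex set \<Rightarrow> vfield set) \<Rightarrow> super_map \<Rightarrow> bool"
  where "susy_automorphism D F \<longleftrightarrow>
    super_automorphism F \<and> (\<forall>p. germ_push F p ` stalk D p = stalk D (base F p))"


subsection \<open>The standard SUSY structure\<close>

text \<open>\<open>D_susy\<close> is a SUSY-1 structure in the sense defined below: \<open>susy1_structure_D_susy\<close>.\<close>

definition V_susy :: vfield
  where "V_susy = d_zeta UNIV + smul zeta_coord (d_z UNIV)"

definition D_susy :: "complex set \<Rightarrow> vfield set"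
  where "D_susy U = {smul s (vrestr U V_susy) | s. s \<in> sections U}"


subsection \<open>SUSY-1 structures\<close>

definition vpart :: "nat \<Rightarrow> vfield \<Rightarrow> vfield"
  where "vpart i Y = (\<lambda>W s. if s \<in> sections W then \<Sum>j<2. gpart (i + j) (Y W (gpart j s)) else 0)"

definition bracket :: "vfield \<Rightarrow> vfield \<Rightarrow> vfield"
  where "bracket Y Z = (\<lambda>W s. \<Sum>i<2. \<Sum>j<2.
      vpart i Y W (vpart j Z W s) - (-1) ^ (i * j) * vpart j Z W (vpart i Y W s))"

definition subsheaf_TX :: "complex set \<Rightarrow> (complex set \<Rightarrow> vfield set) \<Rightarrow> bool"
  where "subsheaf_TX U D \<longleftrightarrow> (\<forall>W. open W \<longrightarrow> W \<subseteq> U \<longrightarrow>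
      D W \<subseteq> TX W \<and> 0 \<in> D W \<and>
      (\<forall>Y\<in>D W. \<forall>Z\<in>D W. Y + Z \<in> D W) \<and>
      (\<forall>s\<in>sections W. \<forall>Y\<in>D W. smul s Y \<in> D W) \<and>
      (\<forall>i. \<forall>Y\<in>D W. vpart i Y \<in> D W) \<and>
      (\<forall>W'. open W' \<longrightarrow> W' \<subseteq> W \<longrightarrow> (\<forall>Y\<in>D W. vrestr W' Y \<in> D W')) \<and>
      (\<forall>Y\<in>TX W. (\<forall>p\<in>W. \<exists>W'. open W' \<and> p \<in> W' \<and> W' \<subseteq> W \<and> vrestr W' Y \<in> D W') \<longrightarrow> Y \<in> D W))"

definition locally_direct_0_1 :: "(complex set \<Rightarrow> vfield set) \<Rightarrow> bool"
  where "locally_direct_0_1 D \<longleftrightarrow> (\<forall>p. \<exists>U. open U \<and> p \<in> U \<and>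
      (\<exists>Y\<in>D U. vpart 1 Y = Y \<and>
        (\<forall>W. open W \<longrightarrow> W \<subseteq> U \<longrightarrow>
          D W = {smul s (vrestr W Y) | s. s \<in> sections W} \<and>
          (\<forall>s\<in>sections W. smul s (vrestr W Y) = 0 \<longrightarrow> s = 0))) \<and>
      (\<exists>E. subsheaf_TX U E \<and>
        (\<forall>W. open W \<longrightarrow> W \<subseteq> U \<longrightarrow>
          D W \<inter> E W = {0} \<and> TX W = {A + B | A B. A \<in> D W \<and> B \<in> E W})))"

definition rsmul :: "vfield \<Rightarrow> superfun \<Rightarrow> vfield"
  where "rsmul Y s = (\<Sum>i<2. \<Sum>j<2. (-1) ^ (i * j) * smul (gpart j s) (vpart i Y))"

text \<open>The tensor product \<open>D(U) \<otimes> D(U)\<close> over the sections on \<open>U\<close>: formal sums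
  \<open>\<Sum> Y\<^sub>i \<otimes> Z\<^sub>i\<close> are lists of pairs, and \<open>tensor_eq D U\<close> is equality of the tensors they denote.\<close>

inductive tensor_eq :: "(complex set \<Rightarrow> vfield set) \<Rightarrow> complex set
    \<Rightarrow> (vfield \<times> vfield) list \<Rightarrow> (vfield \<times> vfield) list \<Rightarrow> bool"
  for D U where
  tensor_refl: "tensor_eq D U xs xs"
| tensor_sym: "tensor_eq D U xs ys \<Longrightarrow> tensor_eq D U ys xs"
| tensor_trans: "tensor_eq D U xs ys \<Longrightarrow> tensor_eq D U ys zs \<Longrightarrow> tensor_eq D U xs zs"
| tensor_append: "tensor_eq D U xs xs' \<Longrightarrow> tensor_eq D U ys ys' \<Longrightarrow> tensor_eq D U (xs @ ys) (xs' @ ys')"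
| tensor_comm: "tensor_eq D U (xs @ ys) (ys @ xs)"
| tensor_zero: "Z \<in> D U \<Longrightarrow> tensor_eq D U [(0, Z)] []"
| tensor_add_left: "Y \<in> D U \<Longrightarrow> Y' \<in> D U \<Longrightarrow> Z \<in> D U \<Longrightarrow> tensor_eq D U [(Y + Y', Z)] [(Y, Z), (Y', Z)]"
| tensor_add_right: "Y \<in> D U \<Longrightarrow> Z \<in> D U \<Longrightarrow> Z' \<in> D U \<Longrightarrow> tensor_eq D U [(Y, Z + Z')] [(Y, Z), (Y, Z')]"
| tensor_balanced: "Y \<in> D U \<Longrightarrow> Z \<in> D U \<Longrightarrow> s \<in> sections U \<Longrightarrow>
    tensor_eq D U [(rsmul Y s, Z)] [(Y, smul s Z)]"

definition bracket_sum :: "(vfield \<times> vfield) list \<Rightarrow> vfield"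
  where "bracket_sum xs = (\<Sum>(Y, Z)\<leftarrow>xs. bracket Y Z)"

text \<open>The last two clauses say that \<open>D \<otimes> D \<rightarrow> TX/D\<close> is bijective on stalks, that is, an
  isomorphism of sheaves.\<close>

definition susy1_structure :: "(complex set \<Rightarrow> vfield set) \<Rightarrow> bool"
  where "susy1_structure D \<longleftrightarrow> subsheaf_TX UNIV D \<and> locally_direct_0_1 D \<and>
    (\<forall>U xs. open U \<longrightarrow> set xs \<subseteq> D U \<times> D U \<longrightarrow> bracket_sum xs \<in> D U \<longrightarrow>
      (\<forall>p\<in>U. \<exists>W. open W \<and> p \<in> W \<and> W \<subseteq> U \<and> tensor_eq D W (map (map_prod (vrestr W) (vrestr W)) xs) [])) \<and>
    (\<forall>U Y. open U \<longrightarrow> Y \<in> TX U \<longrightarrow>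
      (\<forall>p\<in>U. \<exists>W xs. open W \<and> p \<in> W \<and> W \<subseteq> U \<and> set xs \<subseteq> D W \<times> D W \<and>
        vrestr W Y - bracket_sum xs \<in> D W))"


subsection \<open>Basic facts, and the standard structure is a SUSY-1 structure\<close>

lemma grassmann_simps [simp]:
  "body 0 = 0" "soul 0 = 0" "body 1 = 1" "soul 1 = 0"
  "body (a + b) = body a + body b" "soul (a + b) = soul a + soul b"
  "body (- a) = - body a" "soul (- a) = - soul a"
  "body (a - b) = body a - body b" "soul (a - b) = soul a - soul b"
  "body (a * b) = body a * body b" "soul (a * b) = body a * soul b + soul a * body b"
  by (simp_all add: zero_grassmann_def one_grassmann_def plus_grassmann_def
      uminus_grassmann_def minus_grassmann_def times_grassmann_def)

lemma grassmann_numeral [simp]: "body (numeral n) = numeral n" "soul (numeral n) = 0"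
  by (induction n) (simp_all only: numeral.simps grassmann_simps add_0_left)

lemma grassmann_eq_iff: "a = b \<longleftrightarrow> body a = body b \<and> soul a = soul b"
  using grassmann.expand by blast

lemma cst_simps [simp]: "body (cst c x) = c" "soul (cst c x) = 0"
  by (simp_all add: cst_def)

lemma coord_simps [simp]: "body (z_coord x) = x" "soul (z_coord x) = 0"
    "body (zeta_coord x) = 0" "soul (zeta_coord x) = 1"
  by (simp_all add: z_coord_def zeta_coord_def)

lemma gpart_simps [simp]: "body (gpart j s x) = (if even j then body (s x) else 0)"
    "soul (gpart j s x) = (if even j then 0 else soul (s x))"
  by (simp_all add: gpart_def)

lemma restr_simps [simp]: "restr V s x = (if x \<in> V then s x else 0)"
  by (simp add: restr_def)

lemma fun_minus_simps [simp]: fixes f g :: "'a \<Rightarrow> 'b::group_add"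
  shows "(f - g) x = f x - g x" "(- f) x = - f x"
  by (simp_all add: fun_diff_def)

lemma neg_one_power_simps [simp]:
  "((-1) ^ n :: superfun) x = (-1) ^ n" "body ((-1) ^ n) = (-1) ^ n" "soul ((-1) ^ n) = 0"
  "((-1) ^ n :: vfield) W = (-1) ^ n"
  by (induction n) auto

lemma superfun_eqI:
  assumes "\<And>x. body (s x) = body (t x)" "\<And>x. soul (s x) = soul (t x)"
  shows "s = (t :: superfun)"
  using assms by (simp add: fun_eq_iff grassmann_eq_iff)

lemma sections_iff: "s \<in> sections U \<longleftrightarrow> (\<lambda>x. body (s x)) holomorphic_on U \<and>
    (\<lambda>x. soul (s x)) holomorphic_on U \<and> (\<forall>x. x \<notin> U \<longrightarrow> s x = 0)"
  by (simp add: sections_def)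

lemma sections_hol [holomorphic_intros]:
  "s \<in> sections U \<Longrightarrow> (\<lambda>x. body (s x)) holomorphic_on U"
  "s \<in> sections U \<Longrightarrow> (\<lambda>x. soul (s x)) holomorphic_on U"
  by (simp_all add: sections_iff)

lemma sections_off: "s \<in> sections U \<Longrightarrow> x \<notin> U \<Longrightarrow> s x = 0"
  by (simp add: sections_iff)

lemma sections_0 [simp]: "0 \<in> sections U"
  by (simp add: sections_iff)

lemma sections_add [simp]: "s \<in> sections U \<Longrightarrow> t \<in> sections U \<Longrightarrow> s + t \<in> sections U"
  by (auto simp: sections_iff intro!: holomorphic_intros)

lemma sections_uminus [simp]: "s \<in> sections U \<Longrightarrow> - s \<in> sections U"
  by (auto simp: sections_iff intro!: holomorphic_intros)

lemma sections_diff [simp]: "s \<in> sections U \<Longrightarrow> t \<in> sections U \<Longrightarrow> s - t \<in> sections U"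
  by (auto simp: sections_iff intro!: holomorphic_intros)

lemma sections_mult [simp]: "s \<in> sections U \<Longrightarrow> t \<in> sections U \<Longrightarrow> s * t \<in> sections U"
  by (auto simp: sections_iff intro!: holomorphic_intros)

lemma sections_cst_mult [simp]: "s \<in> sections U \<Longrightarrow> cst c * s \<in> sections U"
  by (auto simp: sections_iff intro!: holomorphic_intros)

lemma sections_mult_zeta [simp]: "s \<in> sections U \<Longrightarrow> s * zeta_coord \<in> sections U"
  by (auto simp: sections_iff intro!: holomorphic_intros)

lemma sections_gpart [simp]: "s \<in> sections U \<Longrightarrow> gpart j s \<in> sections U"
  by (cases "even j") (auto simp: sections_iff grassmann_eq_iff)

lemma restr_in_sections:
  assumes "(\<lambda>x. body (s x)) holomorphic_on U" "(\<lambda>x. soul (s x)) holomorphic_on U"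
  shows "restr U s \<in> sections U"
proof -
  have "(\<lambda>x. body (restr U s x)) holomorphic_on U \<longleftrightarrow> (\<lambda>x. body (s x)) holomorphic_on U"
    "(\<lambda>x. soul (restr U s x)) holomorphic_on U \<longleftrightarrow> (\<lambda>x. soul (s x)) holomorphic_on U"
    by (rule holomorphic_cong; simp)+
  then show ?thesis using assms by (simp add: sections_iff)
qed

lemma sections_restr: "s \<in> sections U \<Longrightarrow> V \<subseteq> U \<Longrightarrow> restr V s \<in> sections V"
  by (meson restr_in_sections sections_hol holomorphic_on_subset)

lemma sections_restr_global [simp]:
  "restr U 1 \<in> sections U" "restr U (cst c) \<in> sections U" "restr U z_coord \<in> sections U"
  "restr U zeta_coord \<in> sections U" "cst c \<in> sections UNIV" "z_coord \<in> sections UNIV" 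
  "zeta_coord \<in> sections UNIV"
  by (rule restr_in_sections; simp)+ (auto simp: sections_iff)

lemma restr_self: "s \<in> sections U \<Longrightarrow> restr U s = s"
  by (auto simp: fun_eq_iff sections_off)

lemma restr_restr: "V \<subseteq> U \<Longrightarrow> restr V (restr U s) = restr V s"
  by (auto simp: fun_eq_iff)

lemma restr_ring: "restr V (s + t) = restr V s + restr V t" "restr V (s * t) = restr V s * restr V t"
  "restr V (s * t) = restr V s * t" "restr V 0 = 0" "restr V (- s) = - restr V s" "restr V (s - t) = restr V s - restr V t"
  by (auto simp: fun_eq_iff)

text \<open>The explicit vector fields \<open>u \<partial>\<^sub>z + v \<partial>\<^sub>\<zeta>\<close>.\<close>

definition vf :: "complex set \<Rightarrow> superfun \<Rightarrow> superfun \<Rightarrow> vfield"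
  where "vf U u v = smul u (d_z U) + smul v (d_zeta U)"

definition dz :: "superfun \<Rightarrow> superfun"
  where "dz s = (\<lambda>x. Grass (deriv (\<lambda>x. body (s x)) x) (deriv (\<lambda>x. soul (s x)) x))"

lemma dz_simps [simp]: "body (dz s x) = deriv (\<lambda>x. body (s x)) x" "soul (dz s x) = deriv (\<lambda>x. soul (s x)) x"
  by (simp_all add: dz_def)

lemma vf_eq: "vf U u v W s = (if open W \<and> W \<subseteq> U \<and> s \<in> sections W
   then restr W (u * dz s + v * (\<lambda>x. Grass (soul (s x)) 0)) else 0)"
  by (auto simp: vf_def d_z_def d_zeta_def smul_def dz_def fun_eq_iff)

lemma vf_apply: assumes "open W" "W \<subseteq> U" "s \<in> sections W"
  shows "vf U u v W s x = (if x \<in> W then u x * dz s x + v x * Grass (soul (s x)) 0 else 0)"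
  using assms by (auto simp: vf_eq)

lemma vf_off: "\<not> (open W \<and> W \<subseteq> U \<and> s \<in> sections W) \<Longrightarrow> vf U u v W s = 0"
  by (simp only: vf_eq if_False)

lemma dz_in_sections: "open W \<Longrightarrow> s \<in> sections W \<Longrightarrow> restr W (dz s) \<in> sections W"
  by (rule restr_in_sections) (auto intro!: holomorphic_intros)

lemma vf_sections:
  assumes "open U" "u \<in> sections U" "v \<in> sections U" "open W" "W \<subseteq> U" "s \<in> sections W"
  shows "vf U u v W s \<in> sections W"
proof -
  have *: "(\<lambda>x. body (u x)) holomorphic_on W" "(\<lambda>x. soul (u x)) holomorphic_on W" 
    "(\<lambda>x. body (v x)) holomorphic_on W" "(\<lambda>x. soul (v x)) holomorphic_on W" 
    using sections_hol assms(2,3) holomorphic_on_subset[OF _ assms(5)] by blast+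
  have "restr W (u * dz s + v * (\<lambda>x. Grass (soul (s x)) 0)) \<in> sections W"
    by (rule restr_in_sections) (use assms * in \<open>auto intro!: holomorphic_intros\<close>)
  then show ?thesis using assms by (simp add: vf_eq)
qed

lemma section_diff [derivative_intros]:
  assumes "s \<in> sections W" "open W" "x \<in> W"
  shows "(\<lambda>x. body (s x)) field_differentiable (at x)" "(\<lambda>x. soul (s x)) field_differentiable (at x)"
  using assms sections_hol holomorphic_on_imp_differentiable_at by blast+

lemma dz_add: assumes "s \<in> sections W" "t \<in> sections W" "open W" "x \<in> W"
  shows "dz (s + t) x = dz s x + dz t x"
  by (simp add: grassmann_eq_iff section_diff[OF assms(1,3,4)] section_diff[OF assms(2,3,4)])

lemma dz_mult: assumes "s \<in> sections W" "t \<in> sections W" "open W" "x \<in> W"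
  shows "dz (s * t) x = dz s x * t x + s x * dz t x"
  by (simp add: grassmann_eq_iff section_diff[OF assms(1,3,4)] section_diff[OF assms(2,3,4)] 
     field_differentiable_mult algebra_simps)

lemma dz_cst_mult: assumes "s \<in> sections W" "open W" "x \<in> W"
  shows "dz (cst c * s) x = cst c x * dz s x"
  by (simp add: grassmann_eq_iff section_diff[OF assms])

lemma dz_restr: assumes "open W" "x \<in> W"
  shows "dz (restr W s) x = dz s x"
proof -
  have "eventually (\<lambda>y. y \<in> W) (nhds x)" using assms eventually_nhds by blast
  then have "eventually (\<lambda>y. restr W s y = s y) (nhds x)" by eventually_elim simp
  then have "deriv (\<lambda>x. body (restr W s x)) x = deriv (\<lambda>x. body (s x)) x"
     "deriv (\<lambda>x. soul (restr W s x)) x = deriv (\<lambda>x. soul (s x)) x"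
    by (auto intro!: deriv_cong_ev elim: eventually_mono)
  then show ?thesis by (simp add: grassmann_eq_iff)
qed

lemma linear_endo_vf:
  assumes "open U" "u \<in> sections U" "v \<in> sections U"
  shows "linear_endo U (vf U u v)"
proof -
  have A: "vf U u v W (s + t) = vf U u v W s + vf U u v W t"
    if "open W" "W \<subseteq> U" "s \<in> sections W" "t \<in> sections W" for W s t
    using that by (auto simp: fun_eq_iff vf_apply dz_add[OF that(3,4,1)] grassmann_eq_iff algebra_simps)
  have B: "vf U u v W (cst c * s) = cst c * vf U u v W s"
    if "open W" "W \<subseteq> U" "s \<in> sections W" for W s c
  proof
    fix x
    have "cst c * s \<in> sections W" using that by simp
    with that show "vf U u v W (cst c * s) x = (cst c * vf U u v W s) x"
      by (cases "x \<in> W"; simp only: vf_apply times_fun_apply)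
         (auto simp add: dz_cst_mult[OF that(3,1)] grassmann_eq_iff algebra_simps section_diff[OF that(3,1)])
  qed
  have C: "vf U u v W' (restr W' s) = restr W' (vf U u v W s)"
    if "open W" "W \<subseteq> U" "s \<in> sections W" "open W'" "W' \<subseteq> W" for W W' s
  proof -
    have "W' \<subseteq> U" using that by blast
    moreover have "restr W' s \<in> sections W'" using that sections_restr by blast
    moreover have "x \<in> W" if "x \<in> W'" for x using \<open>W' \<subseteq> W\<close> that by blast
    ultimately show ?thesis using that by (simp add: fun_eq_iff vf_apply dz_restr)
  qed
  show ?thesis unfolding linear_endo_def
    by (intro conjI allI impI ballI; (rule A B C vf_off vf_sections[OF assms]; assumption))
qed

lemma superderivation_vf:
  assumes "open U" "u \<in> sections U" "v \<in> sections U" "homogeneous i u" "homogeneous (Suc i) v"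
  shows "superderivation U i (vf U u v)"
proof -
  have A: "homogeneous (i + j) (vf U u v W s)"
    if "open W" "W \<subseteq> U" "s \<in> sections W" "homogeneous j s" for W s j
    using that(4) assms(4,5)
    by (auto simp: homogeneous_def fun_eq_iff vf_apply[OF that(1-3)] grassmann_eq_iff split: if_splits)
  have B: "vf U u v W (s * t) = vf U u v W s * t + (-1) ^ (i * j) * (s * vf U u v W t)"
    if "open W" "W \<subseteq> U" "s \<in> sections W" "homogeneous j s" "t \<in> sections W" for W s t j
  proof
    fix x
    have p: "i mod 2 = 0 \<or> i mod 2 = 1" by auto
    show "vf U u v W (s * t) x = (vf U u v W s * t + (-1) ^ (i * j) * (s * vf U u v W t)) x"
    proof (cases "x \<in> W")
      case False then show ?thesis using that by (simp add: vf_apply)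
    next
      case True
      have u: "(if even i then soul (u x) = 0 else body (u x) = 0)" 
           "(if odd i then soul (v x) = 0 else body (v x) = 0)"
        using assms(4,5) by (auto simp: homogeneous_def fun_eq_iff grassmann_eq_iff split: if_splits)
      have s: "\<And>x. (if even j then soul (s x) = 0 else body (s x) = 0)"
        using that(4) by (auto simp: homogeneous_def fun_eq_iff grassmann_eq_iff split: if_splits)
      have s': "(if even j then soul (dz s x) = 0 else body (dz s x) = 0)"
        using s by (auto split: if_splits)
      have "vf U u v W (s * t) x = u x * (dz s x * t x + s x * dz t x) + v x * Grass (soul (s x * t x)) 0"
        using that True by (simp add: vf_apply dz_mult[OF that(3,5,1)])
      then show ?thesis using that True u s[of x] s'
        by (auto simp: vf_apply grassmann_eq_iff algebra_simps split: if_splits)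
    qed
  qed
  show ?thesis unfolding superderivation_def using A B linear_endo_vf[OF assms(1-3)] by blast
qed

lemma vf_add: "vf U u v + vf U u' v' = vf U (u + u') (v + v')"
  by (auto simp: fun_eq_iff vf_eq algebra_simps)

lemma gpart_split: "gpart 0 s + gpart (Suc 0) s = s" "gpart (Suc 0) s + gpart 0 s = s"
  by (auto simp: fun_eq_iff grassmann_eq_iff)

lemma homogeneous_gpart: "homogeneous j (gpart j s)" "homogeneous (Suc (Suc j)) (gpart j s)"
  by (auto simp: homogeneous_def fun_eq_iff grassmann_eq_iff)

lemma vf_in_TX:
  assumes "open U" "u \<in> sections U" "v \<in> sections U"
  shows "vf U u v \<in> TX U"
proof -
  have "vf U u v = vf U (gpart 0 u) (gpart 1 v) + vf U (gpart 1 u) (gpart 0 v)"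
    by (simp add: vf_add gpart_split)
  moreover have "superderivation U 0 (vf U (gpart 0 u) (gpart 1 v))"
    "superderivation U 1 (vf U (gpart 1 u) (gpart 0 v))"
    using assms by (auto intro!: superderivation_vf simp: homogeneous_gpart numeral_2_eq_2)
  ultimately show ?thesis unfolding TX_def by blast
qed

lemma TX_linear_endo:
  assumes "Y \<in> TX U" shows "linear_endo U Y"
proof -
  obtain A B where "Y = A + B" "linear_endo U A" "linear_endo U B"
    using assms by (auto simp: TX_def superderivation_def)
  then show ?thesis
    unfolding linear_endo_def by (auto simp: algebra_simps restr_ring)
qed

lemma TX_even_Leibniz:
  assumes "Y \<in> TX U" "open W" "W \<subseteq> U" "s \<in> sections W" "homogeneous 0 s" "t \<in> sections W"
  shows "Y W (s * t) = Y W s * t + s * Y W t"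
proof -
  obtain A B where *: "Y = A + B" "superderivation U 0 A" "superderivation U 1 B"
    using assms(1) by (auto simp: TX_def)
  have "A W (s * t) = A W s * t + (-1) ^ (0 * 0) * (s * A W t)"
    using *(2) assms(2-) unfolding superderivation_def by blast
  moreover have "B W (s * t) = B W s * t + (-1) ^ (1 * 0) * (s * B W t)"
    using *(3) assms(2-) unfolding superderivation_def by blast
  ultimately show ?thesis using * by (simp add: algebra_simps)
qed

lemma TX_off: "Y \<in> TX U \<Longrightarrow> \<not> (open W \<and> W \<subseteq> U \<and> s \<in> sections W) \<Longrightarrow> Y W s = 0"
  using TX_linear_endo unfolding linear_endo_def by blast

lemma
  assumes "Y \<in> TX U" "open W" "W \<subseteq> U" "s \<in> sections W"
  shows TX_sections: "Y W s \<in> sections W"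
    and TX_add: "t \<in> sections W \<Longrightarrow> Y W (s + t) = Y W s + Y W t"
    and TX_cst: "Y W (cst c * s) = cst c * Y W s"
    and TX_restr: "open W' \<Longrightarrow> W' \<subseteq> W \<Longrightarrow> Y W' (restr W' s) = restr W' (Y W s)"
proof -
  have *: "(\<forall>s\<in>sections W. Y W s \<in> sections W) \<and>
      (\<forall>s\<in>sections W. \<forall>t\<in>sections W. Y W (s + t) = Y W s + Y W t) \<and>
      (\<forall>c. \<forall>s\<in>sections W. Y W (cst c * s) = cst c * Y W s) \<and>
      (\<forall>W'. open W' \<longrightarrow> W' \<subseteq> W \<longrightarrow> (\<forall>s\<in>sections W. Y W' (restr W' s) = restr W' (Y W s)))"
    using TX_linear_endo[OF assms(1)] assms(2,3) unfolding linear_endo_def by simp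
  show "Y W s \<in> sections W" using * assms(4) by simp
  show "t \<in> sections W \<Longrightarrow> Y W (s + t) = Y W s + Y W t" using * assms(4) by simp
  show "Y W (cst c * s) = cst c * Y W s" using * assms(4) by simp
  show "open W' \<Longrightarrow> W' \<subseteq> W \<Longrightarrow> Y W' (restr W' s) = restr W' (Y W s)"
    using * assms(4) by blast
qed

lemma TX_eq_vf:
  assumes Y: "Y \<in> TX U" and U: "open U"
  shows "Y = vf U (Y U (restr U z_coord)) (Y U (restr U zeta_coord))"
    and "Y U (restr U z_coord) \<in> sections U" and "Y U (restr U zeta_coord) \<in> sections U"
proof -
  let ?u = "Y U (restr U z_coord)" and ?v = "Y U (restr U zeta_coord)"
  show "?u \<in> sections U" "?v \<in> sections U"
    by (rule TX_sections[OF Y U]; simp)+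
  show "Y = vf U ?u ?v"
  proof (intro ext)
    fix W s x
    show "Y W s x = vf U ?u ?v W s x"
    proof (cases "open W \<and> W \<subseteq> U \<and> s \<in> sections W")
      case False
      then have "Y W s = 0" "vf U ?u ?v W s = 0" using TX_off[OF Y] vf_off by auto
      then show ?thesis by simp
    next
      case True
      then have W: "open W" and WU: "W \<subseteq> U" and s: "s \<in> sections W" by auto
      note Lei = TX_even_Leibniz[OF Y W WU]
      have Yadd: "Y W (s + t) = Y W s + Y W t" if "s \<in> sections W" "t \<in> sections W" for s t
        by (rule TX_add[OF Y W WU that])
      have Ycst: "Y W (cst c * s) = cst c * Y W s" if "s \<in> sections W" for c s
        by (rule TX_cst[OF Y W WU that])
      have Ysec: "Y W s \<in> sections W" if "s \<in> sections W" for s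
        by (rule TX_sections[OF Y W WU that])
      have Yz: "Y W (restr W z_coord) = restr W ?u"
      proof -
        have "Y W (restr W (restr U z_coord)) = restr W (Y U (restr U z_coord))"
          by (rule TX_restr[OF Y U]) (use W WU in simp_all)
        then show ?thesis by (simp add: restr_restr WU)
      qed
      have Yzeta: "Y W (restr W zeta_coord) = restr W ?v"
      proof -
        have "Y W (restr W (restr U zeta_coord)) = restr W (Y U (restr U zeta_coord))"
          by (rule TX_restr[OF Y U]) (use W WU in simp_all)
        then show ?thesis by (simp add: restr_restr WU)
      qed
      show ?thesis
      proof (cases "x \<in> W")
        case False
        then show ?thesis using Ysec[OF s] by (simp add: vf_apply[OF W WU s] sections_off)
      next
        case x: True
        let ?f = "\<lambda>y. body (s y)" and ?g = "\<lambda>y. soul (s y)"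
        define h where "h = (\<lambda>y. if y = x then deriv ?f x else (?f y - ?f x) / (y - x))"
        define k where "k = (\<lambda>y. if y = x then deriv h x else (h y - h x) / (y - x))"
        define l where "l = (\<lambda>y. if y = x then deriv ?g x else (?g y - ?g x) / (y - x))"
        have hol_h: "h holomorphic_on W"
          unfolding h_def by (rule pole_lemma_open[OF sections_hol(1)[OF s] W])
        have hol_k: "k holomorphic_on W"
          unfolding k_def by (rule pole_lemma_open[OF hol_h W])
        have hol_l: "l holomorphic_on W"
          unfolding l_def by (rule pole_lemma_open[OF sections_hol(2)[OF s] W])
        have h: "?f y = ?f x + (y - x) * h y" for y by (simp add: h_def)
        have k: "h y = h x + (y - x) * k y" for y by (simp add: k_def)
        have l: "?g y = ?g x + (y - x) * l y" for y by (simp add: l_def)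
        have hx: "h x = deriv ?f x" by (simp add: h_def)
        define a where "a = restr W z_coord + restr W (cst (-x))"
        define K where "K = restr W (\<lambda>y. Grass (k y) 0)"
        define H where "H = restr W (\<lambda>y. Grass 0 (l y))"
        define one where "one = restr W 1"
        define ze where "ze = restr W zeta_coord"
        have sec: "a \<in> sections W" "K \<in> sections W" "H \<in> sections W" "one \<in> sections W" "ze \<in> sections W"
          unfolding a_def K_def H_def one_def ze_def using hol_k hol_l
          by (auto intro!: restr_in_sections)
        have hom: "homogeneous 0 a" "homogeneous 0 one" 
          by (auto simp: homogeneous_def a_def one_def fun_eq_iff grassmann_eq_iff)
        have ax: "a x = 0" by (simp add: a_def grassmann_eq_iff x)
        have dec: "s = cst (?f x) * one + (cst (deriv ?f x) * a + (a * (a * K) + (cst (?g x) * ze + a * H)))"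
        proof
          fix y
          show "s y = (cst (?f x) * one + (cst (deriv ?f x) * a + (a * (a * K) + (cst (?g x) * ze + a * H)))) y"
          proof (cases "y \<in> W")
            case False then show ?thesis using s by (simp add: one_def a_def ze_def sections_off)
          next
            case True
            have "?f y = ?f x + (y - x) * (deriv ?f x + (y - x) * k y)"
              unfolding hx[symmetric] k[symmetric] h[symmetric] ..
            then show ?thesis using True l[of y] 
              by (simp add: one_def a_def ze_def K_def H_def grassmann_eq_iff algebra_simps)
          qed
        qed
        have Yone: "Y W one = 0"
        proof -
          have oo: "one * one = one" by (auto simp: one_def fun_eq_iff)
          have "Y W (one * one) = Y W one * one + one * Y W one"
            by (rule Lei) (use sec hom in auto)
          moreover have "Y W one * one = Y W one" "one * Y W one = Y W one"
            using Ysec[OF sec(4)] by (auto simp: one_def fun_eq_iff sections_off)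
          ultimately show ?thesis using oo by simp
        qed
        have Ya: "Y W a = restr W ?u"
        proof -
          have "restr W (cst (-x)) = cst (-x) * one" by (auto simp: one_def fun_eq_iff)
          then show ?thesis unfolding a_def using Ycst[OF sec(4)] \<open>Y W one = 0\<close> Yz sec(4)
            by (subst Yadd) auto
        qed
        have "Y W (cst (?f x) * one + (cst (deriv ?f x) * a + (a * (a * K) + (cst (?g x) * ze + a * H))))
            = cst (deriv ?f x) * restr W ?u + ((restr W ?u * (a * K) + a * Y W (a * K)) 
            + (cst (?g x) * restr W ?v + (restr W ?u * H + a * Y W H)))"
          using sec hom by (simp add: Yadd Ycst Lei Yone Ya Yzeta[folded ze_def])
        then have "Y W s = cst (deriv ?f x) * restr W ?u + ((restr W ?u * (a * K) + a * Y W (a * K)) 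
            + (cst (?g x) * restr W ?v + (restr W ?u * H + a * Y W H)))"
          by (rule trans[OF arg_cong[OF dec, of "Y W"]])
        then have "Y W s x = cst (deriv ?f x) x * ?u x + cst (?g x) x * ?v x + ?u x * H x"
          using x by (simp add: ax)
        moreover have "H x = Grass 0 (deriv ?g x)" using x by (simp add: H_def l_def)
        ultimately show ?thesis using x
          by (simp add: vf_apply[OF W WU s] grassmann_eq_iff algebra_simps)
      qed
    qed
  qed
qed

lemma sum_lt_2: "(\<Sum>j<2::nat. f j) = f 0 + f 1"
  by (simp add: numeral_2_eq_2)

lemma dz_z [simp]: "dz z_coord x = 1" "dz zeta_coord x = 0"
  by (simp_all add: grassmann_eq_iff)

lemma vf_coords:
  assumes "open U" "u \<in> sections U" "v \<in> sections U"
  shows "vf U u v U (restr U z_coord) = u" "vf U u v U (restr U zeta_coord) = v"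
  using assms by (auto simp: fun_eq_iff vf_apply dz_restr sections_off grassmann_eq_iff)

lemma vf_eqD:
  assumes "vf U u v = vf U u' v'" "open U"
    "u \<in> sections U" "v \<in> sections U" "u' \<in> sections U" "v' \<in> sections U"
  shows "u = u'" "v = v'"
  using vf_coords[of U u v] vf_coords[of U u' v'] assms by simp_all

lemma vf_0: "vf U 0 0 = 0"
  by (auto simp: fun_eq_iff vf_eq)

lemma vf_diff: "vf U u v - vf U u' v' = vf U (u - u') (v - v')"
  by (auto simp: fun_eq_iff vf_eq algebra_simps)

lemma smul_vf: "smul t (vf U u v) = vf U (t * u) (t * v)"
  by (auto simp: fun_eq_iff smul_def vf_eq algebra_simps)

lemma vrestr_vf: "W \<subseteq> U \<Longrightarrow> vrestr W (vf U u v) = vf W (restr W u) (restr W v)"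
  by (auto simp: fun_eq_iff vrestr_def vf_eq)

lemma vpart_vf: "vpart i (vf U u v) = vf U (gpart i u) (gpart (Suc i) v)"
proof (intro ext)
  fix W s x
  show "vpart i (vf U u v) W s x = vf U (gpart i u) (gpart (Suc i) v) W s x"
  proof (cases "open W \<and> W \<subseteq> U \<and> s \<in> sections W \<and> x \<in> W")
    case False
    then show ?thesis by (auto simp: vpart_def sum_lt_2 vf_eq gpart_def grassmann_eq_iff)
  next
    case True
    then show ?thesis
      by (auto simp: vpart_def sum_lt_2 vf_apply grassmann_eq_iff)
  qed
qed

lemma subsheaf_TX_rel:
  assumes D: "\<And>W. open W \<Longrightarrow> W \<subseteq> U \<Longrightarrow>
      D W = {vf W u v | u v. u \<in> sections W \<and> v \<in> sections W \<and> (\<forall>x. r (u x) (v x))}"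
    and r: "r 0 0" "\<And>a b a' b'. r a b \<Longrightarrow> r a' b' \<Longrightarrow> r (a + a') (b + b')"
      "\<And>a b c. r a b \<Longrightarrow> r (c * a) (c * b)"
      "\<And>a b. r a b \<Longrightarrow> r (Grass (body a) 0) (Grass 0 (soul b))"
      "\<And>a b. r a b \<Longrightarrow> r (Grass 0 (soul a)) (Grass (body b) 0)"
  shows "subsheaf_TX U D"
  unfolding subsheaf_TX_def
proof (intro allI impI conjI ballI)
  fix W assume W: "open W" "W \<subseteq> U"
  note DW = D[OF W]
  show "D W \<subseteq> TX W" unfolding DW by (auto intro: vf_in_TX[OF W(1)])
  show "0 \<in> D W"
    unfolding DW by (intro CollectI exI[of _ 0] conjI sections_0 vf_0[symmetric]) (simp add: r(1))
  show "Y + Z \<in> D W" if YZ: "Y \<in> D W" "Z \<in> D W" for Y Z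
  proof -
    obtain u v u' v' where *: "Y = vf W u v" "Z = vf W u' v'"
      "u \<in> sections W" "v \<in> sections W" "\<forall>x. r (u x) (v x)"
      "u' \<in> sections W" "v' \<in> sections W" "\<forall>x. r (u' x) (v' x)"
      using YZ unfolding DW by blast
    have "\<forall>x. r ((u + u') x) ((v + v') x)" using *(5,8) by (auto intro: r(2))
    moreover have "u + u' \<in> sections W" "v + v' \<in> sections W" using * by auto
    ultimately show ?thesis unfolding DW *(1,2) vf_add by blast
  qed
  show "smul s Y \<in> D W" if YZ: "s \<in> sections W" "Y \<in> D W" for s Y
  proof -
    obtain u v where *: "Y = vf W u v" "u \<in> sections W" "v \<in> sections W" "\<forall>x. r (u x) (v x)"
      using YZ unfolding DW by blast
    have "\<forall>x. r ((s * u) x) ((s * v) x)" using *(4) by (auto intro: r(3))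
    moreover have "s * u \<in> sections W" "s * v \<in> sections W" using * YZ by auto
    ultimately show ?thesis unfolding DW *(1) smul_vf by blast
  qed
  show "vpart i Y \<in> D W" if YZ: "Y \<in> D W" for i Y
  proof -
    obtain u v where *: "Y = vf W u v" "u \<in> sections W" "v \<in> sections W" "\<forall>x. r (u x) (v x)"
      using YZ unfolding DW by blast
    have "\<forall>x. r (gpart i u x) (gpart (Suc i) v x)" using *(4) by (auto simp: gpart_def intro: r(4,5))
    moreover have "gpart i u \<in> sections W" "gpart (Suc i) v \<in> sections W" using * by auto
    ultimately show ?thesis unfolding DW *(1) vpart_vf by blast
  qed
  show "vrestr W' Y \<in> D W'" if W': "open W'" "W' \<subseteq> W" and YZ: "Y \<in> D W" for W' Y
  proof -
    obtain u v where *: "Y = vf W u v" "u \<in> sections W" "v \<in> sections W" "\<forall>x. r (u x) (v x)"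
      using YZ unfolding DW by blast
    have "\<forall>x. r (restr W' u x) (restr W' v x)" using *(4) by (auto intro: r(1))
    moreover have "restr W' u \<in> sections W'" "restr W' v \<in> sections W'" using * W' sections_restr by auto
    moreover have "W' \<subseteq> U" using W W' by blast
    ultimately show ?thesis unfolding D[OF W'(1) \<open>W' \<subseteq> U\<close>] *(1) vrestr_vf[OF W'(2)] by blast
  qed
  show "Y \<in> D W" if Y: "Y \<in> TX W" and
    loc: "\<forall>p\<in>W. \<exists>W'. open W' \<and> p \<in> W' \<and> W' \<subseteq> W \<and> vrestr W' Y \<in> D W'" for Y
  proof -
    define u where "u = Y W (restr W z_coord)"
    define v where "v = Y W (restr W zeta_coord)"
    have *: "Y = vf W u v" "u \<in> sections W" "v \<in> sections W"
      using TX_eq_vf[OF Y W(1)] unfolding u_def v_def by auto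
    have "r (u x) (v x)" for x
    proof (cases "x \<in> W")
      case False then show ?thesis using * r(1) by (simp add: sections_off)
    next
      case True
      then obtain W' where W': "open W'" "x \<in> W'" "W' \<subseteq> W" "vrestr W' Y \<in> D W'" using loc by blast
      then have "W' \<subseteq> U" using W by blast
      obtain u' v' where **: "vf W' (restr W' u) (restr W' v) = vf W' u' v'"
        "u' \<in> sections W'" "v' \<in> sections W'" "\<forall>x. r (u' x) (v' x)"
        using W'(4) unfolding D[OF W'(1) \<open>W' \<subseteq> U\<close>] *(1) vrestr_vf[OF W'(3)] by blast
      have "restr W' u = u'" "restr W' v = v'"
        using vf_eqD[OF **(1) W'(1) _ _ **(2,3)] sections_restr *(2,3) W'(3) by blast+
      then have "u x = u' x" "v x = v' x" using W'(2) by auto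
      then show ?thesis using **(4) by simp
    qed
    then show ?thesis unfolding DW using * by blast
  qed
qed

abbreviation (input) Dvf :: "complex set \<Rightarrow> superfun \<Rightarrow> vfield"
  where "Dvf U s \<equiv> vf U (s * zeta_coord) s"

lemma V_susy_eq: "V_susy = vf UNIV zeta_coord 1"
  by (auto simp: V_susy_def vf_def smul_def fun_eq_iff d_zeta_def grassmann_eq_iff sections_off)

lemma smul_V_susy: "smul s (vrestr U V_susy) = Dvf U s"
  by (auto simp: V_susy_eq vrestr_vf smul_vf fun_eq_iff vf_eq)

lemma D_susy_eq: "D_susy U = {Dvf U s | s. s \<in> sections U}"
  unfolding D_susy_def smul_V_susy ..

lemma D_susy_rel:
  "D_susy U = {vf U u v | u v. u \<in> sections U \<and> v \<in> sections U \<and> (\<forall>x. u x = v x * Grass 0 1)}"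
  (is "_ = ?R")
proof -
  have "(\<forall>x. u x = v x * Grass 0 1) \<longleftrightarrow> u = v * zeta_coord" for u v :: superfun
    by (simp add: fun_eq_iff zeta_coord_def)
  then show ?thesis unfolding D_susy_eq by auto
qed

lemma subsheaf_D_susy: "subsheaf_TX U D_susy"
  by (rule subsheaf_TX_rel[OF D_susy_rel]) (auto simp: grassmann_eq_iff algebra_simps)

lemma locally_direct_D_susy: "locally_direct_0_1 D_susy"
  unfolding locally_direct_0_1_def
proof (intro allI exI[of _ UNIV] conjI)
  have V: "V_susy = Dvf UNIV 1" by (simp add: V_susy_eq)
  have one: "1 \<in> sections UNIV" by (simp add: sections_iff)
  show "\<exists>Y\<in>D_susy UNIV. vpart 1 Y = Y \<and>
        (\<forall>W. open W \<longrightarrow> W \<subseteq> UNIV \<longrightarrow>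
          D_susy W = {smul s (vrestr W Y) | s. s \<in> sections W} \<and>
          (\<forall>s\<in>sections W. smul s (vrestr W Y) = 0 \<longrightarrow> s = 0))"
  proof (intro bexI[of _ V_susy] conjI allI impI ballI)
    have "gpart (Suc 0) zeta_coord = zeta_coord" "gpart (Suc (Suc 0)) 1 = 1"
      by (auto simp: fun_eq_iff grassmann_eq_iff)
    then show "vpart 1 V_susy = V_susy" by (simp add: V_susy_eq vpart_vf)
    show "D_susy W = {smul s (vrestr W V_susy) | s. s \<in> sections W}" for W
      by (simp add: D_susy_def)
    show "s = 0" if "open W" "s \<in> sections W" "smul s (vrestr W V_susy) = 0" for W s
    proof -
      have "vf W (s * zeta_coord) s = vf W 0 0" using that(3) by (simp add: smul_V_susy vf_0)
      then show "s = 0" using vf_eqD(2)[of W "s * zeta_coord" s 0 0] that by simp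
    qed
    show "V_susy \<in> D_susy UNIV" using one unfolding D_susy_eq V by blast
  qed
  define E where "E W = {vf W u v | u v. u \<in> sections W \<and> v \<in> sections W \<and> (\<forall>x. v x = 0)}" for W
  show "\<exists>E. subsheaf_TX UNIV E \<and>
        (\<forall>W. open W \<longrightarrow> W \<subseteq> UNIV \<longrightarrow>
          D_susy W \<inter> E W = {0} \<and> TX W = {A + B | A B. A \<in> D_susy W \<and> B \<in> E W})"
  proof (intro exI[of _ E] conjI allI impI)
    show E: "subsheaf_TX UNIV E"
      by (rule subsheaf_TX_rel[OF E_def]) (auto simp: grassmann_eq_iff)
    fix W :: "complex set" assume W: "open W"
    show "D_susy W \<inter> E W = {0}"
    proof
      show "{0} \<subseteq> D_susy W \<inter> E W"
        using E subsheaf_D_susy[of UNIV] W unfolding subsheaf_TX_def by simp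
      show "D_susy W \<inter> E W \<subseteq> {0}"
      proof
        fix Y assume "Y \<in> D_susy W \<inter> E W"
        then have "Y \<in> D_susy W" "Y \<in> E W" by auto
        then obtain s u v where s: "Y = Dvf W s" "s \<in> sections W" and uv: "Y = vf W u v"
          "u \<in> sections W" "v \<in> sections W" "\<forall>x. v x = 0"
          unfolding D_susy_eq E_def by blast
        then have *: "Y = Dvf W s" "s \<in> sections W" "vf W u v = Dvf W s"
          "u \<in> sections W" "v \<in> sections W" "\<forall>x. v x = 0" by simp_all
        have "v = s" using vf_eqD(2)[OF *(3) W] * by simp
        then have "s = 0" using * by (auto simp: fun_eq_iff)
        then show "Y \<in> {0}" using * by (simp add: vf_0)
      qed
    qed
    show "TX W = {A + B | A B. A \<in> D_susy W \<and> B \<in> E W}"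
    proof
      show "{A + B | A B. A \<in> D_susy W \<and> B \<in> E W} \<subseteq> TX W"
        using W by (auto simp: D_susy_eq E_def vf_add intro!: vf_in_TX)
      show "TX W \<subseteq> {A + B | A B. A \<in> D_susy W \<and> B \<in> E W}"
      proof
        fix Y assume "Y \<in> TX W"
        then obtain u v where Y: "Y = vf W u v" "u \<in> sections W" "v \<in> sections W"
          using TX_eq_vf[OF _ W] by blast
        then have "Y = Dvf W v + vf W (u - v * zeta_coord) 0" by (simp add: vf_add)
        moreover have "Dvf W v \<in> D_susy W" using Y unfolding D_susy_eq by blast
        moreover have "vf W (u - v * zeta_coord) 0 \<in> E W"
          unfolding E_def using Y by (intro CollectI exI[of _ "u - v * zeta_coord"] exI[of _ 0]) simp
        ultimately show "Y \<in> {A + B | A B. A \<in> D_susy W \<and> B \<in> E W}" by blast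
      qed
    qed
  qed
qed simp_all

lemma Dvf_sections:
  assumes "open U" "s \<in> sections U" "open W" "W \<subseteq> U" "w \<in> sections W"
  shows "Dvf U s W w \<in> sections W"
  using assms by (intro vf_sections) auto

lemma Dvf_apply:
  assumes "open W" "W \<subseteq> U" "w \<in> sections W"
  shows "Dvf U s W w x = (if x \<in> W then Grass (body (s x) * soul (w x))
    (body (s x) * deriv (\<lambda>x. body (w x)) x + soul (s x) * soul (w x)) else 0)"
  using assms by (auto simp: vf_apply grassmann_eq_iff)

lemma Dvf_Dvf:
  assumes U: "open U" and s: "s \<in> sections U" and t: "t \<in> sections U"
    and W: "open W" "W \<subseteq> U" and w: "w \<in> sections W"
  shows "Dvf U s W (Dvf U t W w) x = (if x \<in> W then
     Grass (body (s x) * (body (t x) * deriv (\<lambda>x. body (w x)) x + soul (t x) * soul (w x)))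
       (body (s x) * (deriv (\<lambda>x. body (t x)) x * soul (w x) + body (t x) * deriv (\<lambda>x. soul (w x)) x)
        + soul (s x) * (body (t x) * deriv (\<lambda>x. body (w x)) x + soul (t x) * soul (w x))) else 0)"
proof (cases "x \<in> W")
  case False then show ?thesis using Dvf_sections[OF U t W w] by (simp add: Dvf_apply W)
next
  case True
  have "eventually (\<lambda>y. y \<in> W) (nhds x)" using W True eventually_nhds by blast
  then have "eventually (\<lambda>y. body (Dvf U t W w y) = body (t y) * soul (w y)) (nhds x)"
    by eventually_elim (simp add: Dvf_apply W w)
  then have "deriv (\<lambda>y. body (Dvf U t W w y)) x = deriv (\<lambda>y. body (t y) * soul (w y)) x"
    by (rule deriv_cong_ev) simp
  also have "\<dots> = body (t x) * deriv (\<lambda>x. soul (w x)) x + deriv (\<lambda>x. body (t x)) x * soul (w x)"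
    using section_diff[OF t U, of x] section_diff[OF w W(1) True] W True by (subst deriv_mult) auto
  finally have d: "deriv (\<lambda>y. body (Dvf U t W w y)) x = \<dots>" .
  show ?thesis
    unfolding Dvf_apply[OF W Dvf_sections[OF U t W w]] d using True W w by (simp add: Dvf_apply)
qed

definition par :: "superfun \<Rightarrow> superfun"
  where "par t = gpart 0 t - gpart 1 t"

lemma par_in_sections [simp]: "t \<in> sections U \<Longrightarrow> par t \<in> sections U"
  by (simp add: par_def)

lemma vpart_Dvf: "vpart i (Dvf U s) = Dvf U (gpart (Suc i) s)"
proof -
  have "gpart i (s * zeta_coord) = gpart (Suc i) s * zeta_coord"
    by (auto simp: fun_eq_iff grassmann_eq_iff)
  then show ?thesis by (simp add: vpart_vf)
qed

lemma bracket_Dvf: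
  assumes U: "open U" and s: "s \<in> sections U" and t: "t \<in> sections U"
  shows "\<exists>r\<in>sections U. bracket (Dvf U s) (Dvf U t) = vf U (2 * (s * par t) + r * zeta_coord) r"
proof -
  define r where "r = restr U (\<lambda>x. Grass (body (s x) * soul (t x) - body (t x) * soul (s x))
     (body (s x) * deriv (\<lambda>x. body (t x)) x + body (t x) * deriv (\<lambda>x. body (s x)) x))"
  have "r \<in> sections U"
    unfolding r_def by (rule restr_in_sections) (use U s t in \<open>auto intro!: holomorphic_intros\<close>)
  moreover have "bracket (Dvf U s) (Dvf U t) W w x = vf U (2 * (s * par t) + r * zeta_coord) r W w x"
    for W w x
  proof (cases "open W \<and> W \<subseteq> U \<and> w \<in> sections W")
    case False
    then have off: "vf U a b W w = 0" for a b by (rule vf_off)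
    have "vf U a b W 0 = 0" for a b by (auto simp: vf_eq fun_eq_iff grassmann_eq_iff)
    then show ?thesis by (simp add: bracket_def vpart_Dvf off)
  next
    case True
    then have W: "open W" "W \<subseteq> U" and w: "w \<in> sections W" by auto
    note DD = Dvf_Dvf[OF U _ _ W w]
    have g: "gpart j s \<in> sections U" "gpart j t \<in> sections U" for j using s t by auto
    have "bracket (Dvf U s) (Dvf U t) W w x = 
       (Dvf U (gpart 1 s) W (Dvf U (gpart 1 t) W w) x - Dvf U (gpart 1 t) W (Dvf U (gpart 1 s) W w) x)
     + (Dvf U (gpart 1 s) W (Dvf U (gpart (Suc (Suc 0)) t) W w) x - Dvf U (gpart (Suc (Suc 0)) t) W (Dvf U (gpart 1 s) W w) x)
     + (Dvf U (gpart (Suc (Suc 0)) s) W (Dvf U (gpart 1 t) W w) x - Dvf U (gpart 1 t) W (Dvf U (gpart (Suc (Suc 0)) s) W w) x)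
     + (Dvf U (gpart (Suc (Suc 0)) s) W (Dvf U (gpart (Suc (Suc 0)) t) W w) x + Dvf U (gpart (Suc (Suc 0)) t) W (Dvf U (gpart (Suc (Suc 0)) s) W w) x)"
      by (simp add: bracket_def vpart_Dvf sum_lt_2 add.assoc)
    also have "\<dots> = vf U (2 * (s * par t) + r * zeta_coord) r W w x"
      unfolding DD[OF g(1) g(2)] DD[OF g(2) g(1)] vf_apply[OF W w]
      using W by (auto simp: r_def par_def grassmann_eq_iff algebra_simps)
    finally show ?thesis .
  qed
  ultimately show ?thesis by (intro bexI[of _ r]) (auto simp: fun_eq_iff)
qed

lemma rsmul_Dvf: "rsmul (Dvf U s) t = Dvf U (s * par t)"
proof -
  have "rsmul (Dvf U s) t = smul (gpart 0 t) (Dvf U (gpart 1 s)) + smul (gpart 1 t) (Dvf U (gpart 1 s))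
     + (smul (gpart 0 t) (Dvf U (gpart (Suc (Suc 0)) s)) - smul (gpart 1 t) (Dvf U (gpart (Suc (Suc 0)) s)))"
    by (simp add: rsmul_def vpart_Dvf sum_lt_2)
  also have "\<dots> = vf U (gpart 0 t * (gpart 1 s * zeta_coord) + gpart 1 t * (gpart 1 s * zeta_coord)
     + (gpart 0 t * (gpart (Suc (Suc 0)) s * zeta_coord) - gpart 1 t * (gpart (Suc (Suc 0)) s * zeta_coord)))
     (gpart 0 t * gpart 1 s + gpart 1 t * gpart 1 s + (gpart 0 t * gpart (Suc (Suc 0)) s - gpart 1 t * gpart (Suc (Suc 0)) s))"
    by (simp only: smul_vf vf_add vf_diff)
  also have "gpart 0 t * (gpart 1 s * zeta_coord) + gpart 1 t * (gpart 1 s * zeta_coord)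
     + (gpart 0 t * (gpart (Suc (Suc 0)) s * zeta_coord) - gpart 1 t * (gpart (Suc (Suc 0)) s * zeta_coord)) = s * par t * zeta_coord"
    by (simp add: fun_eq_iff grassmann_eq_iff par_def algebra_simps)
  also have "gpart 0 t * gpart 1 s + gpart 1 t * gpart 1 s + (gpart 0 t * gpart (Suc (Suc 0)) s - gpart 1 t * gpart (Suc (Suc 0)) s)
     = s * par t"
    by (simp add: fun_eq_iff grassmann_eq_iff par_def algebra_simps)
  finally show ?thesis .
qed

lemma bracket_sum_D_susy:
  assumes U: "open U" and "set xs \<subseteq> D_susy U \<times> D_susy U"
  shows "\<exists>c\<in>sections U. \<exists>r\<in>sections U. bracket_sum xs = vf U (2 * c + r * zeta_coord) r \<and>
     tensor_eq D_susy U xs [(Dvf U c, Dvf U (restr U 1))]"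
  using assms(2)
proof (induction xs)
  case Nil
  have "tensor_eq D_susy U [(0, Dvf U (restr U 1))] []"
    by (rule tensor_zero) (auto simp: D_susy_eq)
  then have "tensor_eq D_susy U [] [(Dvf U 0, Dvf U (restr U 1))]"
    by (simp add: vf_0 tensor_sym)
  moreover have "bracket_sum [] = vf U (2 * 0 + 0 * zeta_coord) 0"
    by (simp add: bracket_sum_def vf_0)
  ultimately show ?case using sections_0 by blast
next
  case (Cons y ys)
  then have "set ys \<subseteq> D_susy U \<times> D_susy U" by simp
  from Cons.IH[OF this]
  obtain c r where c: "c \<in> sections U" "r \<in> sections U" "bracket_sum ys = vf U (2 * c + r * zeta_coord) r"
     "tensor_eq D_susy U ys [(Dvf U c, Dvf U (restr U 1))]" by blast
  obtain s t where y: "y = (Dvf U s, Dvf U t)" and st: "s \<in> sections U" "t \<in> sections U"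
    using Cons.prems by (auto simp: D_susy_eq)
  obtain q where q: "q \<in> sections U" "bracket (Dvf U s) (Dvf U t) = vf U (2 * (s * par t) + q * zeta_coord) q"
    using bracket_Dvf[OF U st] by blast
  let ?one = "Dvf U (restr U 1)"
  have "smul t ?one = Dvf U (t * restr U 1)" by (simp add: smul_vf mult.assoc)
  also have "t * restr U 1 = t" using st by (auto simp: fun_eq_iff sections_off)
  finally have t1: "smul t ?one = Dvf U t" .
  have inD: "Dvf U s \<in> D_susy U" if "s \<in> sections U" for s using that unfolding D_susy_eq by blast
  have "tensor_eq D_susy U [(rsmul (Dvf U s) t, ?one)] [(Dvf U s, smul t ?one)]"
    by (rule tensor_balanced) (use inD st in auto)
  then have "tensor_eq D_susy U [y] [(Dvf U (s * par t), ?one)]"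
    unfolding rsmul_Dvf t1 y by (rule tensor_sym)
  from tensor_append[OF this c(4)]
  have "tensor_eq D_susy U (y # ys) [(Dvf U (s * par t), ?one), (Dvf U c, ?one)]" by simp
  then have 1: "tensor_eq D_susy U (y # ys) [(Dvf U (s * par t), ?one), (Dvf U c, ?one)]" .
  have 2: "tensor_eq D_susy U [(Dvf U (s * par t) + Dvf U c, ?one)] [(Dvf U (s * par t), ?one), (Dvf U c, ?one)]"
    by (rule tensor_add_left) (use inD st c in auto)
  have "Dvf U (s * par t) + Dvf U c = Dvf U (s * par t + c)" by (simp only: vf_add distrib_right)
  then have "tensor_eq D_susy U (y # ys) [(Dvf U (s * par t + c), ?one)]"
    using tensor_trans[OF 1 tensor_sym[OF 2]] by simp
  moreover have "bracket_sum (y # ys) = vf U (2 * (s * par t + c) + (q + r) * zeta_coord) (q + r)"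
    using c(3) q(2) by (simp add: bracket_sum_def y vf_add algebra_simps)
  moreover have "s * par t + c \<in> sections U" "q + r \<in> sections U" using st c q by auto
  ultimately show ?case by blast
qed

theorem susy1_structure_D_susy: "susy1_structure D_susy"
  unfolding susy1_structure_def
proof (intro conjI allI impI ballI)
  show "subsheaf_TX UNIV D_susy" by (rule subsheaf_D_susy)
  show "locally_direct_0_1 D_susy" by (rule locally_direct_D_susy)
next
  fix U xs p
  assume U: "open U" and xs: "set xs \<subseteq> D_susy U \<times> D_susy U" and b: "bracket_sum xs \<in> D_susy U" and p: "p \<in> U"
  obtain c r where c: "c \<in> sections U" "r \<in> sections U" "bracket_sum xs = vf U (2 * c + r * zeta_coord) r"
     "tensor_eq D_susy U xs [(Dvf U c, Dvf U (restr U 1))]" using bracket_sum_D_susy[OF U xs] by blast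
  obtain s where s: "s \<in> sections U" "vf U (2 * c + r * zeta_coord) r = Dvf U s"
    using b c(3) unfolding D_susy_eq by auto
  have "2 * c + r * zeta_coord \<in> sections U" unfolding mult_2 by (intro sections_add sections_mult_zeta c)
  with vf_eqD[OF s(2) U] c s have "2 * c + r * zeta_coord = s * zeta_coord" "r = s" by auto
  then have "2 * c = 0" by simp
  then have "c = 0" by (auto simp: fun_eq_iff grassmann_eq_iff)
  have "tensor_eq D_susy U [(0, Dvf U (restr U 1))] []"
    by (rule tensor_zero) (auto simp: D_susy_eq)
  then have "tensor_eq D_susy U xs []" using c(4) \<open>c = 0\<close> by (auto simp: vf_0 intro: tensor_trans)
  moreover have "vrestr U Y = Y" if "Y \<in> D_susy U" for Y
    using that by (auto simp: D_susy_eq vrestr_vf restr_self)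
  then have "map (map_prod (vrestr U) (vrestr U)) xs = xs"
    using xs by (intro map_idI) auto
  ultimately show "\<exists>W. open W \<and> p \<in> W \<and> W \<subseteq> U \<and> tensor_eq D_susy W (map (map_prod (vrestr W) (vrestr W)) xs) []"
    using U p by (intro exI[of _ U]) simp
next
  fix U Y p
  assume U: "open U" and Y: "Y \<in> TX U" and p: "p \<in> U"
  obtain u v where uv: "Y = vf U u v" "u \<in> sections U" "v \<in> sections U" using TX_eq_vf[OF Y U] by blast
  define s where "s = cst (1/2) * (u - v * zeta_coord)"
  have s: "s \<in> sections U" using uv by (simp add: s_def)
  obtain r where r: "r \<in> sections U" 
    "bracket (Dvf U s) (Dvf U (restr U 1)) = vf U (2 * (s * par (restr U 1)) + r * zeta_coord) r"
    using bracket_Dvf[OF U s, of "restr U 1"] by auto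
  have "2 * (s * par (restr U 1)) = u - v * zeta_coord"
    using uv by (auto simp: fun_eq_iff grassmann_eq_iff par_def s_def sections_off)
  then have br: "bracket_sum [(Dvf U s, Dvf U (restr U 1))] = vf U (u - v * zeta_coord + r * zeta_coord) r"
    by (simp add: bracket_sum_def r(2))
  have "u - (u - v * zeta_coord + r * zeta_coord) = (v - r) * zeta_coord" by (simp add: algebra_simps)
  then have "vrestr U Y - bracket_sum [(Dvf U s, Dvf U (restr U 1))] = Dvf U (v - r)"
    unfolding br using uv by (simp add: vrestr_vf restr_self vf_diff)
  also have "\<dots> \<in> D_susy U" using uv r unfolding D_susy_eq by (intro CollectI exI[of _ "v - r"]) simp
  finally have "vrestr U Y - bracket_sum [(Dvf U s, Dvf U (restr U 1))] \<in> D_susy U" .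
  moreover have "set [(Dvf U s, Dvf U (restr U 1))] \<subseteq> D_susy U \<times> D_susy U"
    using s by (auto simp: D_susy_eq)
  ultimately show "\<exists>W xs. open W \<and> p \<in> W \<and> W \<subseteq> U \<and> set xs \<subseteq> D_susy W \<times> D_susy W \<and>
        vrestr W Y - bracket_sum xs \<in> D_susy W"
    using U p by blast
qed


subsection \<open>Morphisms and coordinates\<close>

lemma super_morphism_vimage_open: "super_morphism F \<Longrightarrow> open U \<Longrightarrow> open (base F -` U)"
  by (simp add: super_morphism_def open_vimage)

lemma super_morphism_off: "super_morphism F \<Longrightarrow> \<not> (open U \<and> s \<in> sections U) \<Longrightarrow> pull F U s = 0"
  unfolding super_morphism_def by blast

lemma
  assumes F: "super_morphism F" and U: "open U"
  shows pull_one: "pull F U (restr U 1) = restr (base F -` U) 1"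
    and pull_sections: "s \<in> sections U \<Longrightarrow> pull F U s \<in> sections (base F -` U)"
    and pull_add: "s \<in> sections U \<Longrightarrow> t \<in> sections U \<Longrightarrow> pull F U (s + t) = pull F U s + pull F U t"
    and pull_mult: "s \<in> sections U \<Longrightarrow> t \<in> sections U \<Longrightarrow> pull F U (s * t) = pull F U s * pull F U t"
    and pull_cst: "s \<in> sections U \<Longrightarrow> pull F U (cst c * s) = cst c * pull F U s"
    and pull_homogeneous: "s \<in> sections U \<Longrightarrow> homogeneous j s \<Longrightarrow> homogeneous j (pull F U s)"
    and pull_restr: "s \<in> sections U \<Longrightarrow> open V \<Longrightarrow> V \<subseteq> U \<Longrightarrow>
        pull F V (restr V s) = restr (base F -` V) (pull F U s)"
    and pull_local: "s \<in> sections U \<Longrightarrow> base F p \<in> U \<Longrightarrow> body (s (base F p)) = 0 \<Longrightarrow>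
        body (pull F U s p) = 0"
proof -
  have *: "(\<forall>s\<in>sections U. pull F U s \<in> sections (base F -` U)) \<and>
      pull F U (restr U 1) = restr (base F -` U) 1 \<and>
      (\<forall>s\<in>sections U. \<forall>t\<in>sections U. pull F U (s + t) = pull F U s + pull F U t) \<and>
      (\<forall>s\<in>sections U. \<forall>t\<in>sections U. pull F U (s * t) = pull F U s * pull F U t) \<and>
      (\<forall>c. \<forall>s\<in>sections U. pull F U (cst c * s) = cst c * pull F U s) \<and>
      (\<forall>j. \<forall>s\<in>sections U. homogeneous j s \<longrightarrow> homogeneous j (pull F U s)) \<and>
      (\<forall>V. open V \<longrightarrow> V \<subseteq> U \<longrightarrow>
        (\<forall>s\<in>sections U. pull F V (restr V s) = restr (base F -` V) (pull F U s))) \<and>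
      (\<forall>s\<in>sections U. \<forall>p. base F p \<in> U \<longrightarrow> body (s (base F p)) = 0 \<longrightarrow> body (pull F U s p) = 0)"
    using F U unfolding super_morphism_def by (elim conjE) (erule allE[of _ U], erule (1) impE)
  then show "pull F U (restr U 1) = restr (base F -` U) 1" by simp
  from * show "s \<in> sections U \<Longrightarrow> pull F U s \<in> sections (base F -` U)" by simp
  from * show "s \<in> sections U \<Longrightarrow> t \<in> sections U \<Longrightarrow> pull F U (s + t) = pull F U s + pull F U t" by simp
  from * show "s \<in> sections U \<Longrightarrow> t \<in> sections U \<Longrightarrow> pull F U (s * t) = pull F U s * pull F U t" by simp
  from * show "s \<in> sections U \<Longrightarrow> pull F U (cst c * s) = cst c * pull F U s" by simp
  from * show "s \<in> sections U \<Longrightarrow> homogeneous j s \<Longrightarrow> homogeneous j (pull F U s)" by simp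
  from * show "s \<in> sections U \<Longrightarrow> open V \<Longrightarrow> V \<subseteq> U \<Longrightarrow>
        pull F V (restr V s) = restr (base F -` V) (pull F U s)" by simp
  from * show "s \<in> sections U \<Longrightarrow> base F p \<in> U \<Longrightarrow> body (s (base F p)) = 0 \<Longrightarrow>
        body (pull F U s p) = 0" by simp
qed

definition coord_map :: "superfun \<Rightarrow> superfun \<Rightarrow> super_map"
  where "coord_map w \<eta> = \<lparr>base = (\<lambda>x. body (w x)),
     pull = (\<lambda>U s. if open U \<and> s \<in> sections U then restr ((\<lambda>x. body (w x)) -` U)
       (\<lambda>x. Grass (body (s (body (w x)))) (soul (s (body (w x))) * soul (\<eta> x))) else 0)\<rparr>"

lemma super_morphism_coord_map:
  assumes w: "w \<in> sections UNIV" and h: "\<eta> \<in> sections UNIV"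
  shows "super_morphism (coord_map w \<eta>)"
proof -
  let ?b = "\<lambda>x. body (w x)"
  let ?F = "coord_map w \<eta>"
  have b: "base ?F = ?b" by (simp add: coord_map_def)
  have cont: "continuous_on UNIV ?b"
    using sections_hol(1)[OF w] holomorphic_on_imp_continuous_on by blast
  have P: "pull ?F U s = restr (?b -` U) (\<lambda>x. Grass (body (s (?b x))) (soul (s (?b x)) * soul (\<eta> x)))"
    if "open U" "s \<in> sections U" for U s using that by (simp add: coord_map_def)
  show ?thesis
    unfolding super_morphism_def b
  proof (intro conjI allI impI ballI)
    show "continuous_on UNIV ?b" by (rule cont)
    show "pull ?F U s = 0" if "\<not> (open U \<and> s \<in> sections U)" for U s
      using that by (simp only: coord_map_def super_map.simps if_False)
  next
    fix U :: "complex set" assume U: "open U"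
    note PU = P[OF U]
    show "pull ?F U s \<in> sections (?b -` U)" if s: "s \<in> sections U" for s
      unfolding PU[OF s]
    proof (rule restr_in_sections)
      have w': "?b holomorphic_on (?b -` U)" "(\<lambda>x. soul (\<eta> x)) holomorphic_on (?b -` U)"
        using sections_hol[OF w] sections_hol[OF h] holomorphic_on_subset by blast+
      have im: "?b ` (?b -` U) \<subseteq> U" by auto
      have c: "(\<lambda>x. body (s (?b x))) holomorphic_on (?b -` U)" "(\<lambda>x. soul (s (?b x))) holomorphic_on (?b -` U)"
        using holomorphic_on_compose_gen[OF w'(1) sections_hol(1)[OF s] im]
          holomorphic_on_compose_gen[OF w'(1) sections_hol(2)[OF s] im] by (simp_all add: o_def)
      show "(\<lambda>x. body (Grass (body (s (?b x))) (soul (s (?b x)) * soul (\<eta> x)))) holomorphic_on ?b -` U"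
        using c by simp
      show "(\<lambda>x. soul (Grass (body (s (?b x))) (soul (s (?b x)) * soul (\<eta> x)))) holomorphic_on ?b -` U"
        using c w' by (auto intro!: holomorphic_intros)
    qed
    show "pull ?F U (restr U 1) = restr (?b -` U) 1"
      by (auto simp: PU fun_eq_iff grassmann_eq_iff)
    fix s assume s: "s \<in> sections U"
    show "pull ?F U (s + t) = pull ?F U s + pull ?F U t" "pull ?F U (s * t) = pull ?F U s * pull ?F U t"
      if t: "t \<in> sections U" for t
      unfolding PU[OF s] PU[OF t] PU[OF sections_add[OF s t]] PU[OF sections_mult[OF s t]]
      by (auto simp: fun_eq_iff grassmann_eq_iff algebra_simps)
    show "pull ?F U (cst c * s) = cst c * pull ?F U s" for c
      unfolding PU[OF s] PU[OF sections_cst_mult[OF s]]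
      by (auto simp: fun_eq_iff grassmann_eq_iff algebra_simps)
    show "homogeneous j (pull ?F U s)" if "homogeneous j s" for j
      using that unfolding PU[OF s] by (auto simp: homogeneous_def fun_eq_iff grassmann_eq_iff split: if_splits)
    show "pull ?F V (restr V s) = restr (?b -` V) (pull ?F U s)" if "open V" "V \<subseteq> U" for V
      unfolding PU[OF s] P[OF that(1) sections_restr[OF s that(2)]] using that(2)
      by (auto simp: fun_eq_iff grassmann_eq_iff)
    show "body (pull ?F U s p) = 0" if "?b p \<in> U" "body (s (?b p)) = 0" for p
      using that unfolding PU[OF s] by simp
  qed
qed

lemma base_eq_body_pull:
  assumes F: "super_morphism F"
  shows "base F p = body (pull F UNIV z_coord p)"
proof -
  let ?q = "base F p"
  have "(cst (- ?q)) \<in> sections UNIV" by simp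
  have one: "1 \<in> sections UNIV" "restr UNIV 1 = (1 :: superfun)" by (simp_all add: sections_iff restr_def one_fun_def)
  let ?s = "z_coord + cst (- ?q) * 1"
  have s: "?s \<in> sections UNIV" using one by (intro sections_add sections_cst_mult) auto
  have "body (pull F UNIV ?s p) = 0"
    by (rule pull_local[OF F open_UNIV s]) simp_all
  moreover have "pull F UNIV ?s = pull F UNIV z_coord + cst (- ?q) * pull F UNIV 1"
    using one by (simp only: pull_add[OF F open_UNIV] pull_cst[OF F open_UNIV] sections_cst_mult sections_restr_global)
  moreover have "pull F UNIV 1 = 1"
    using pull_one[OF F open_UNIV] unfolding vimage_UNIV one(2) .
  ultimately show ?thesis by simp
qed

lemma body_pull_eq:
  assumes F: "super_morphism F" and U: "open U" and s: "s \<in> sections U" and p: "base F p \<in> U"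
  shows "body (pull F U s p) = body (s (base F p))"
proof -
  let ?c = "body (s (base F p))"
  let ?t = "s + cst (- ?c) * restr U 1"
  have "body (pull F U ?t p) = 0"
    by (rule pull_local[OF F U]) (use s p in auto)
  moreover have "pull F U ?t = pull F U s + cst (- ?c) * restr (base F -` U) 1"
    using s by (simp only: pull_add[OF F U] pull_cst[OF F U] pull_one[OF F U] sections_cst_mult sections_restr_global)
  ultimately show ?thesis using p by simp
qed

text \<open>The chart theorem: a morphism is determined by the pull-backs of the coordinates.\<close>

lemma super_morphism_eq_coord_map:
  assumes F: "super_morphism F"
  shows "F = coord_map (pull F UNIV z_coord) (pull F UNIV zeta_coord)"
proof (rule super_map.equality)
  let ?w = "pull F UNIV z_coord" and ?h = "pull F UNIV zeta_coord"
  have b: "base F = (\<lambda>x. body (?w x))" by (simp add: fun_eq_iff base_eq_body_pull[OF F])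
  show "base F = base (coord_map ?w ?h)" by (simp add: b coord_map_def)
  show "pull F = pull (coord_map ?w ?h)"
  proof (intro ext)
    fix U s p
    show "pull F U s p = pull (coord_map ?w ?h) U s p"
    proof (cases "open U \<and> s \<in> sections U")
      case False
      then have "pull F U s = 0" "pull (coord_map ?w ?h) U s = 0"
        using super_morphism_off[OF F, of U s] by (auto simp: coord_map_def)
      then show ?thesis by simp
    next
      case True
      then have U: "open U" and s: "s \<in> sections U" by auto
      show ?thesis
      proof (cases "base F p \<in> U")
        case False
        then have "pull F U s p = 0" using pull_sections[OF F U s] by (simp add: sections_off)
        then show ?thesis using False True by (simp add: coord_map_def base_eq_body_pull[OF F])
      next
        case p: True
        define g where "g = restr U (\<lambda>x. Grass (soul (s x)) 0)"
        have g: "g \<in> sections U"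
          unfolding g_def by (rule restr_in_sections) (use sections_hol[OF s] in simp_all)
        define ze where "ze = restr U zeta_coord"
        have ze: "ze \<in> sections U" by (simp add: ze_def)
        have dec: "gpart 0 s + g * ze = s"
          using s by (auto simp: g_def ze_def fun_eq_iff grassmann_eq_iff sections_off)
        have "pull F U s = pull F U (gpart 0 s + g * ze)" by (simp only: dec)
        also have "\<dots> = pull F U (gpart 0 s) + pull F U g * pull F U ze"
          using s g ze by (simp only: pull_add[OF F U] pull_mult[OF F U] sections_gpart sections_mult)
        finally have 1: "pull F U s p = pull F U (gpart 0 s) p + pull F U g p * pull F U ze p" by simp
        have "pull F U ze = restr (base F -` U) ?h"
          unfolding ze_def by (rule pull_restr[OF F open_UNIV]) (use U in auto)
        then have 2: "pull F U ze p = ?h p" using p by simp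
        have hz: "homogeneous 1 ?h"
          by (rule pull_homogeneous[OF F open_UNIV]) (auto simp: homogeneous_def fun_eq_iff grassmann_eq_iff)
        have ev: "soul (pull F U t p) = 0" "body (pull F U t p) = body (t (base F p))"
          if "t \<in> sections U" "homogeneous 0 t" for t
        proof -
          have "gpart 0 (pull F U t) = pull F U t"
            using pull_homogeneous[OF F U that] by (simp add: homogeneous_def)
          then have "gpart 0 (pull F U t) p = pull F U t p" by simp
          then show "soul (pull F U t p) = 0" by (simp add: grassmann_eq_iff)
          show "body (pull F U t p) = body (t (base F p))" by (rule body_pull_eq[OF F U that(1) p])
        qed
        have h0: "body (?h p) = 0"
        proof -
          have "gpart 1 ?h p = ?h p" using hz by (simp add: homogeneous_def)
          then show ?thesis by (simp add: grassmann_eq_iff)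
        qed
        have "homogeneous 0 (gpart 0 s)" "homogeneous 0 g"
          by (auto simp: homogeneous_def g_def fun_eq_iff grassmann_eq_iff)
        with ev[of "gpart 0 s"] ev[of g] s g p
        have "pull F U s p = Grass (body (s (base F p))) (soul (s (base F p)) * soul (?h p))"
          unfolding 1 2 by (simp add: grassmann_eq_iff h0 g_def)
        then show ?thesis using p True by (simp add: coord_map_def base_eq_body_pull[OF F])
      qed
    qed
  qed
qed simp

theorem ex1_super_morphism:
  assumes "w \<in> sections UNIV" "homogeneous 0 w" "\<eta> \<in> sections UNIV" "homogeneous 1 \<eta>"
  shows "\<exists>!F. super_morphism F \<and> has_coords F w \<eta>"
proof (rule ex1I[of _ "coord_map w \<eta>"])
  have 1: "gpart 0 w = w" "gpart 1 \<eta> = \<eta>" using assms by (simp_all add: homogeneous_def)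
  have "soul (gpart 0 w x) = soul (w x)" "body (gpart 1 \<eta> x) = body (\<eta> x)" for x by (simp_all only: 1)
  then have "soul (w x) = 0" "body (\<eta> x) = 0" for x by simp_all
  then have "has_coords (coord_map w \<eta>) w \<eta>"
    by (simp add: has_coords_def coord_map_def fun_eq_iff grassmann_eq_iff)
  then show "super_morphism (coord_map w \<eta>) \<and> has_coords (coord_map w \<eta>) w \<eta>"
    using super_morphism_coord_map assms by blast
  show "F = coord_map w \<eta>" if "super_morphism F \<and> has_coords F w \<eta>" for F
    using super_morphism_eq_coord_map[of F] that by (simp add: has_coords_def)
qed

end

theory Submission
  imports Defs "HOL-Computational_Algebra.Fundamental_Theorem_Algebra"
begin

text \<open>A morphism is given by an entire function \<open>f\<close> (its base map) and an entire function \<open>g\<close>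
  with \<open>F(z, \<zeta>) = (f(z), g(z) \<zeta>)\<close>.  If \<open>F\<close> is an automorphism, then \<open>f\<close> is a
  homeomorphism, so it is proper and hence a polynomial; its derivative has no zero, so it is
  affine.  A direct computation gives \<open>dF(s V) = F\<^sub>*(s \<zeta> f') \<partial>\<^sub>z + F\<^sub>*(s g) \<partial>\<^sub>\<zeta>\<close> with
  \<open>F\<^sub>* = (F\<^sup>*)\<^sup>-\<^sup>1\<close>, which for \<open>s = 1\<close> is a multiple of
  \<open>V\<close> exactly when \<open>f' = g\<^sup>2\<close>.  For affine \<open>f\<close> this makes \<open>g\<close> a constant square root of
  the slope.\<close>

section \<open>Entire homeomorphisms of the plane\<close>

lemma inj_entire_imp_affine:
  fixes f :: "complex \<Rightarrow> complex"
  assumes f: "f holomorphic_on UNIV" and h: "continuous_on UNIV h"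
    and hf: "\<And>x. h (f x) = x" and fh: "\<And>y. f (h y) = y"
  shows "\<exists>a b. a \<noteq> 0 \<and> f = (\<lambda>z. a * z + b)"
proof -
  \<comment> \<open>Properness: the preimage of \<open>K\<close> under \<open>f\<close> is its image
    under the continuous inverse \<open>h\<close>.\<close>
  have "compact {z. f z \<in> K}" if "compact K" for K
  proof -
    have "{z. f z \<in> K} = h ` K"
    proof (intro set_eqI iffI)
      show "z \<in> h ` K" if "z \<in> {z. f z \<in> K}" for z
        using that hf[of z] by (metis image_eqI mem_Collect_eq)
    qed (auto simp: fh)
    then show ?thesis
      using compact_continuous_image[OF continuous_on_subset[OF h] that] by simp
  qed
  \<comment> \<open>An entire function is proper exactly when it is a nonconstant
    polynomial.\<close>
  then obtain c n where c: "f = (\<lambda>z. \<Sum>i\<le>n. c i * z ^ i)"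
    using proper_map_polyfun_eq[OF f] by blast
  define p where "p = (\<Sum>i\<le>n. monom (c i) i)"
  have p: "f = poly p"
    by (simp add: fun_eq_iff c p_def poly_sum poly_monom)
  have "inj f" using hf by (metis injI)
  then have "deriv f z \<noteq> 0" for z
    by (rule holomorphic_injective_imp_regular[OF f open_UNIV _ UNIV_I])
  then have nz: "poly (pderiv p) z \<noteq> 0" for z
    by (simp add: p DERIV_imp_deriv[OF poly_DERIV])
  \<comment> \<open>A nonconstant \<open>pderiv p\<close> would have a root by the fundamental
    theorem of algebra.\<close>
  then have "constant (poly (pderiv p))"
    using Fundamental_Theorem_Algebra.fundamental_theorem_of_algebra[of "pderiv p"] by auto
  then have "degree (pderiv p) = 0"
    by (simp add: constant_degree)
  then have "degree p \<le> 1" by (simp add: degree_pderiv)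
  then have ab: "p = [:coeff p 0, coeff p 1:]"
    by (intro poly_eqI) (auto simp: coeff_pCons coeff_eq_0 split: nat.split)
  have "poly (pderiv [:coeff p 0, coeff p 1:]) 0 \<noteq> 0" using nz[of 0] ab by metis
  then have "coeff p 1 \<noteq> 0" by (simp add: pderiv_pCons)
  moreover have "f z = coeff p 1 * z + coeff p 0" for z
    using arg_cong[OF ab, of "\<lambda>q. poly q z"] by (simp add: p algebra_simps)
  ultimately show ?thesis by (intro exI conjI ext)
qed

section \<open>Morphisms through two entire functions\<close>

text \<open>The function \<open>g\<close> in \<open>F(z, \<zeta>) = (f(z), g(z) \<zeta>)\<close>.\<close>

definition odd_factor :: "super_map \<Rightarrow> complex \<Rightarrow> complex"
  where "odd_factor F x = soul (pull F UNIV zeta_coord x)"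

text \<open>The chart theorem in pointwise form; it lets pull-backs be evaluated through
  \<open>base F\<close> and \<open>odd_factor F\<close> alone.\<close>

lemma pull_apply:
  assumes F: "super_morphism F" and U: "open U" and s: "s \<in> sections U"
  shows "pull F U s x = (if base F x \<in> U
    then Grass (body (s (base F x))) (soul (s (base F x)) * odd_factor F x) else 0)"
proof -
  have "pull F U s x = pull (coord_map (pull F UNIV z_coord) (pull F UNIV zeta_coord)) U s x"
    using super_morphism_eq_coord_map[OF F] by simp
  then show ?thesis
    using U s by (simp add: coord_map_def odd_factor_def base_eq_body_pull[OF F])
qed

lemma base_holomorphic: "super_morphism F \<Longrightarrow> base F holomorphic_on UNIV"
  using sections_hol(1)[OF pull_sections[OF _ open_UNIV, of F z_coord]]
  by (simp add: base_eq_body_pull[symmetric])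

lemma odd_factor_holomorphic: "super_morphism F \<Longrightarrow> odd_factor F holomorphic_on UNIV"
  using sections_hol(2)[OF pull_sections[OF _ open_UNIV, of F zeta_coord]]
  by (simp add: odd_factor_def[abs_def])

text \<open>Translates coordinate expressions of \<open>F\<close> into equations for its two entire
  functions.\<close>

lemma has_coords_iff:
  assumes "super_morphism F"
  shows "has_coords F w \<eta> \<longleftrightarrow>
    w = (\<lambda>x. Grass (base F x) 0) \<and> \<eta> = (\<lambda>x. Grass 0 (odd_factor F x))"
  by (auto simp: has_coords_def fun_eq_iff pull_apply[OF assms open_UNIV])

lemma pull_0:
  assumes F: "super_morphism F" shows "pull F U 0 = 0"
proof (cases "open U")
  case True then show ?thesis
    by (auto simp: fun_eq_iff pull_apply[OF F True] grassmann_eq_iff)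
next
  case False then show ?thesis using super_morphism_off[OF F] by blast
qed

section \<open>Composition and inverses\<close>

lemma super_comp_simps [simp]:
  "base (super_comp G F) x = base G (base F x)"
  "pull (super_comp G F) U s = pull F (base G -` U) (pull G U s)"
  by (simp_all add: super_comp_def)

lemma super_id_simps [simp]:
  "base super_id x = x"
  "pull super_id U s = (if open U \<and> s \<in> sections U then s else 0)"
  by (simp_all add: super_id_def)

lemma super_comp_assoc: "super_comp H (super_comp G F) = super_comp (super_comp H G) F"
  by (simp add: super_comp_def fun_eq_iff vimage_comp)

text \<open>Composing with \<open>super_id\<close> forces the value 0 at arguments that are not
  sections over an open set. A morphism already has the value 0 there, so nothing changes.\<close>

lemma super_comp_id:
  assumes F: "super_morphism F"
  shows "super_comp super_id F = F" "super_comp F super_id = F"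
proof -
  have id: "base super_id -` U = U" for U by auto
  have off: "pull F U s = 0" if "\<not> (open U \<and> s \<in> sections U)" for U s
    using super_morphism_off[OF F that] .
  show "super_comp super_id F = F"
    by (intro super_map.equality ext) (auto simp: id pull_0[OF F] off)
  show "super_comp F super_id = F"
  proof (intro super_map.equality ext)
    fix U s x
    show "pull (super_comp F super_id) U s x = pull F U s x"
      using off[of U s] pull_sections[OF F, of U s] super_morphism_vimage_open[OF F, of U]
      by (cases "open U \<and> s \<in> sections U") auto
  qed simp_all
qed

text \<open>The cancellation \<open>H = H (F G) = (H F) G = G\<close> makes inverses unique, so the
  definite description in \<open>super_inv\<close> denotes \<open>G\<close>.\<close>

lemma super_inv_eq:
  assumes F: "super_morphism F" and G: "inverse_of F G"
  shows "super_inv F = G"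
  unfolding super_inv_def
proof (rule the_equality)
  show "inverse_of F G" by (rule G)
  fix H assume H: "inverse_of F H"
  have "H = super_comp H (super_comp F G)"
    using G H by (simp add: inverse_of_def super_comp_id)
  also have "\<dots> = G"
    using G H by (simp add: super_comp_assoc) (simp add: inverse_of_def super_comp_id)
  finally show "H = G" .
qed

lemma inverse_ofD:
  assumes "inverse_of F G"
  shows "super_morphism G" "base G (base F x) = x" "base F (base G y) = y"
    and "open U \<Longrightarrow> s \<in> sections U \<Longrightarrow> pull G (base F -` U) (pull F U s) = s"
proof -
  from assms show "super_morphism G" by (simp add: inverse_of_def)
  have GF: "super_comp G F = super_id" and FG: "super_comp F G = super_id"
    using assms by (simp_all add: inverse_of_def)
  show "base G (base F x) = x" using arg_cong[OF GF, of "\<lambda>H. base H x"] by simp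
  show "base F (base G y) = y" using arg_cong[OF FG, of "\<lambda>H. base H y"] by simp
  show "pull G (base F -` U) (pull F U s) = s" if "open U" "s \<in> sections U"
    using arg_cong[OF FG, of "\<lambda>H. pull H U s"] that by simp
qed

text \<open>Compare the \<zeta>-components in \<open>G\<^sup>* F\<^sup>* \<zeta> = \<zeta>\<close>:
  each of the two pull-backs contributes its odd factor, that of \<open>F\<close> being evaluated at
  \<open>base G x\<close>.\<close>

lemma odd_factor_inverse:
  assumes F: "super_morphism F" and G: "inverse_of F G"
  shows "odd_factor F (base G x) * odd_factor G x = 1"
proof -
  have "soul (pull G UNIV (pull F UNIV zeta_coord) x) = 1"
    using inverse_ofD(4)[OF G open_UNIV, of zeta_coord] by simp
  moreover have "pull F UNIV zeta_coord \<in> sections UNIV"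
    using pull_sections[OF F open_UNIV, of zeta_coord] by simp
  ultimately show ?thesis
    by (simp add: pull_apply[OF inverse_ofD(1)[OF G] open_UNIV] odd_factor_def[of F])
qed

text \<open>Replaces images under \<open>base F\<close>, as they occur in \<open>germ_push\<close>,
  by preimages, whose openness follows from continuity of \<open>base G\<close>.\<close>

lemma base_image_eq_vimage:
  assumes "inverse_of F G" shows "base F ` U = base G -` U"
proof (intro set_eqI iffI)
  show "y \<in> base F ` U" if "y \<in> base G -` U" for y
    using that inverse_ofD(3)[OF assms, of y] by (metis image_eqI vimageD)
qed (auto simp: inverse_ofD(2)[OF assms])

section \<open>Push-forward of the sections of the SUSY structure\<close>

text \<open>The coefficients are the pull-backs under \<open>G\<close> of
  \<open>s V(f) = s \<zeta> f'\<close> and \<open>s V(g \<zeta>) = s g\<close>, where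
  \<open>F\<^sup>* z = f\<close> and \<open>F\<^sup>* \<zeta> = g \<zeta>\<close>. Equality on an
  arbitrary section \<open>t\<close> is then the chain rule.\<close>

lemma push_Dvf:
  assumes F: "super_morphism F" and G: "inverse_of F G" and U: "open U" and s: "s \<in> sections U"
  shows "push F (Dvf U s) = vf (base F ` U)
    (pull G U (s * zeta_coord * restr U (\<lambda>x. Grass (deriv (base F) x) 0)))
    (pull G U (s * restr U (\<lambda>x. Grass (odd_factor F x) 0)))"
    (is "_ = vf _ ?u ?v")
proof (intro ext)
  fix W t x
  note G' = inverse_ofD(1)[OF G]
  have inv: "super_inv F = G" by (rule super_inv_eq[OF F G])
  have fg: "base F (base G y) = y" and gf: "base G (base F y) = y" for y
    using inverse_ofD[OF G] by auto
  let ?W = "base F -` W"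
  show "push F (Dvf U s) W t x = vf (base F ` U) ?u ?v W t x"
  proof (cases "open W \<and> W \<subseteq> base F ` U \<and> t \<in> sections W")
    case False
    \<comment> \<open>Both sides must also agree at invalid arguments. If \<open>W\<close> lies in
      the image of \<open>U\<close>, the pull-back of \<open>t\<close> is already 0; otherwise
      \<open>?W\<close> is not contained in \<open>U\<close> and the field itself gives 0.\<close>
    have V0: "Dvf U s A 0 = 0" for A
      by (auto simp: vf_eq fun_eq_iff grassmann_eq_iff)
    have "push F (Dvf U s) W t = 0"
    proof (cases "W \<subseteq> base F ` U")
      case True
      then have "pull F W t = 0" using False super_morphism_off[OF F] by blast
      then show ?thesis by (simp add: push_def V0 inv pull_0[OF G'])
    next
      case False
      then have "\<not> ?W \<subseteq> U"
        unfolding base_image_eq_vimage[OF G] by (auto simp: subset_iff) (metis fg)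
      then have "Dvf U s ?W (pull F W t) = 0" by (intro vf_off) auto
      then show ?thesis by (simp add: push_def inv pull_0[OF G'])
    qed
    moreover have "vf (base F ` U) ?u ?v W t = 0" by (rule vf_off[OF False])
    ultimately show ?thesis by simp
  next
    case True
    then have W: "open W" and WU: "W \<subseteq> base F ` U" and t: "t \<in> sections W" by auto
    have W': "open ?W" "?W \<subseteq> U"
      using super_morphism_vimage_open[OF F W] WU unfolding base_image_eq_vimage[OF G]
      by (auto simp: subset_iff gf)
    have Ft: "pull F W t \<in> sections ?W" by (rule pull_sections[OF F W t])
    have D: "Dvf U s ?W (pull F W t) \<in> sections ?W"
      by (rule Dvf_sections[OF U s W' Ft])
    show ?thesis
    proof (cases "x \<in> W")
      case False
      then show ?thesis
        by (simp add: push_def inv pull_apply[OF G' W'(1) D] fg vf_apply[OF W WU t])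
    next
      case x: True
      let ?y = "base G x"
      have y: "?y \<in> U" "?y \<in> ?W" using x WU W' fg by auto
      \<comment> \<open>The formula for the body of \<open>pull F W t\<close> is available only on
        \<open>?W\<close>, so the derivative is taken through a neighbourhood of \<open>?y\<close>
        before the chain rule applies.\<close>
      have "eventually (\<lambda>z. z \<in> ?W) (nhds ?y)" using W'(1) y(2) eventually_nhds by blast
      then have "eventually (\<lambda>z. body (pull F W t z) = body (t (base F z))) (nhds ?y)"
        by eventually_elim (simp add: pull_apply[OF F W t])
      then have "deriv (\<lambda>z. body (pull F W t z)) ?y = deriv (\<lambda>z. body (t (base F z))) ?y"
        by (rule deriv_cong_ev) simp
      also have "\<dots> = deriv ((\<lambda>z. body (t z)) \<circ> base F) ?y" by (simp add: o_def)
      also have "\<dots> = deriv (\<lambda>z. body (t z)) x * deriv (base F) ?y"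
        using holomorphic_on_imp_differentiable_at[OF base_holomorphic[OF F] open_UNIV]
          section_diff[OF t W x] by (subst deriv_chain) (simp_all add: fg)
      finally have d: "deriv (\<lambda>z. body (pull F W t z)) ?y = \<dots>" .
      have DFt: "Dvf U s ?W (pull F W t) ?y = Grass
          (body (s ?y) * (soul (t x) * odd_factor F ?y))
          (body (s ?y) * (deriv (\<lambda>z. body (t z)) x * deriv (base F) ?y) +
            soul (s ?y) * (soul (t x) * odd_factor F ?y))"
        unfolding Dvf_apply[OF W' Ft] d using x y by (simp add: pull_apply[OF F W t] fg)
      have sec: "s * zeta_coord * restr U (\<lambda>x. Grass (deriv (base F) x) 0) \<in> sections U"
        "s * restr U (\<lambda>x. Grass (odd_factor F x) 0) \<in> sections U"
        using s U holomorphic_on_subset[OF base_holomorphic[OF F], of U]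
          holomorphic_on_subset[OF odd_factor_holomorphic[OF F], of U]
        by (auto intro!: sections_mult sections_mult_zeta restr_in_sections holomorphic_deriv)
      show ?thesis
        using odd_factor_inverse[OF F G, of x] x y
        by (simp add: push_def inv pull_apply[OF G' W'(1) D] fg vf_apply[OF W WU t]
            DFt pull_apply[OF G' U sec(1)]
            pull_apply[OF G' U sec(2)] grassmann_eq_iff)
          (simp add: algebra_simps)
    qed
  qed
qed

section \<open>Germs and their push-forward\<close>

lemma vrestr_vrestr: "W' \<subseteq> W \<Longrightarrow> vrestr W' (vrestr W Y) = vrestr W' Y"
  by (auto simp: vrestr_def fun_eq_iff)

lemma vrestr_eq_mono: "vrestr W Y = vrestr W Z \<Longrightarrow> W' \<subseteq> W \<Longrightarrow> vrestr W' Y = vrestr W' Z"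
  using vrestr_vrestr[of W' W Y] vrestr_vrestr[of W' W Z] by simp

lemma mem_germ_iff:
  "(U', Y') \<in> germ p (U, Y) \<longleftrightarrow> open U' \<and> p \<in> U' \<and> Y' \<in> TX U' \<and>
    (\<exists>W. open W \<and> p \<in> W \<and> W \<subseteq> U \<inter> U' \<and> vrestr W Y = vrestr W Y')"
  by (simp only: germ_def prod.case mem_Collect_eq)

text \<open>Agreement on \<open>W\<close> and agreement with a representative on \<open>A\<close>
  are chained on \<open>A \<inter> W\<close>. The assumptions are symmetric in the two fields, so
  equality of germs comes from two such inclusions.\<close>

lemma germ_mono:
  assumes "open W" "p \<in> W" "W \<subseteq> U \<inter> U'" "vrestr W Y = vrestr W Y'"
  shows "germ p (U, Y) \<subseteq> germ p (U', Y')"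
proof (rule subrelI)
  fix C Z assume "(C, Z) \<in> germ p (U, Y)"
  then obtain A where CZ: "open C" "p \<in> C" "Z \<in> TX C"
    and A: "open A" "p \<in> A" "A \<subseteq> U \<inter> C" "vrestr A Y = vrestr A Z"
    unfolding mem_germ_iff by (elim conjE exE)
  have "vrestr (A \<inter> W) Y' = vrestr (A \<inter> W) Y"
    by (rule vrestr_eq_mono[OF assms(4)[symmetric]]) simp
  also have "\<dots> = vrestr (A \<inter> W) Z" by (rule vrestr_eq_mono[OF A(4)]) simp
  finally have "vrestr (A \<inter> W) Y' = vrestr (A \<inter> W) Z" .
  moreover have "open (A \<inter> W)" "p \<in> A \<inter> W" "A \<inter> W \<subseteq> U' \<inter> C"
    using A assms by auto
  ultimately show "(C, Z) \<in> germ p (U', Y')"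
    unfolding mem_germ_iff using CZ by (intro conjI exI[of _ "A \<inter> W"])
qed

lemma germ_eqI:
  assumes "open W" "p \<in> W" "W \<subseteq> U \<inter> U'" "vrestr W Y = vrestr W Y'"
  shows "germ p (U, Y) = germ p (U', Y')"
  using germ_mono[OF assms] germ_mono[of W p U' U Y' Y] assms by auto

lemma germ_self: "open U \<Longrightarrow> p \<in> U \<Longrightarrow> Y \<in> TX U \<Longrightarrow> (U, Y) \<in> germ p (U, Y)"
  unfolding mem_germ_iff by (intro conjI exI[of _ U]) auto

text \<open>The push-forward over \<open>A\<close> evaluates the field only over the preimage of
  \<open>A\<close>, so fields agreeing on \<open>W\<close> have push-forwards agreeing on the image
  of \<open>W\<close>. The union in \<open>germ_push\<close> therefore runs over a nonempty constant
  family.\<close>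

lemma germ_push_germ:
  assumes F: "super_morphism F" and G: "inverse_of F G"
    and U: "open U" "p \<in> U" and Y: "Y \<in> TX U"
  shows "germ_push F p (germ p (U, Y)) = germ (base F p) (base F ` U, push F Y)"
proof -
  have im: "base F ` A = base G -` A" for A by (rule base_image_eq_vimage[OF G])
  have "germ (base F p) (base F ` U', push F Y') = germ (base F p) (base F ` U, push F Y)"
    if rep: "(U', Y') \<in> germ p (U, Y)" for U' Y'
  proof -
    obtain W where W: "open W" "p \<in> W" "W \<subseteq> U \<inter> U'" "vrestr W Y = vrestr W Y'"
      using rep unfolding mem_germ_iff by (elim conjE exE)
    have "Y (base F -` A) t = Y' (base F -` A) t" if "A \<subseteq> base F ` W" for A t
    proof -
      have "base F -` A \<subseteq> W" using that inverse_ofD(2)[OF G] unfolding im by force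
      then show ?thesis using fun_cong[OF fun_cong[OF W(4)], of "base F -` A" t]
        by (simp add: vrestr_def)
    qed
    then have "vrestr (base F ` W) (push F Y') A t = vrestr (base F ` W) (push F Y) A t" for A t
      by (simp add: vrestr_def push_def)
    then have "vrestr (base F ` W) (push F Y') = vrestr (base F ` W) (push F Y)"
      by (intro ext) simp
    moreover have "open (base F ` W)"
      unfolding im by (rule super_morphism_vimage_open[OF inverse_ofD(1)[OF G] W(1)])
    moreover have "base F p \<in> base F ` W" "base F ` W \<subseteq> base F ` U' \<inter> base F ` U"
      using W by auto
    ultimately show ?thesis by (intro germ_eqI[of "base F ` W"])
  qed
  moreover have "germ p (U, Y) \<noteq> {}" using germ_self[OF U Y] by auto
  ultimately show ?thesis unfolding germ_push_def by (intro SUP_eq_const) auto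
qed

lemma Dvf_in_TX: "open U \<Longrightarrow> s \<in> sections U \<Longrightarrow> Dvf U s \<in> TX U"
  by (rule vf_in_TX) auto

lemma stalk_D_susy:
  "stalk D_susy p = {germ p (U, Dvf U s) | U s. open U \<and> p \<in> U \<and> s \<in> sections U}"
  unfolding stalk_def D_susy_eq by blast

section \<open>Necessity of the relation between the two entire functions\<close>

text \<open>Testing the germ of \<open>V_susy\<close> at \<open>p\<close> suffices: its image must
  be the germ of some \<open>Dvf U s\<close>, whose coefficient at \<open>\<partial>\<^sub>z\<close>
  is \<zeta> times the one at \<open>\<partial>\<^sub>\<zeta>\<close>. Comparing souls at
  \<open>?q\<close> gives the relation.\<close>

lemma susy_automorphism_deriv_base:
  assumes susy: "susy_automorphism D_susy F" and F: "super_morphism F" and G: "inverse_of F G"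
  shows "deriv (base F) p = (odd_factor F p)\<^sup>2"
proof -
  let ?q = "base F p"
  let ?u = "pull G UNIV (1 * zeta_coord * restr UNIV (\<lambda>x. Grass (deriv (base F) x) 0))"
  let ?v = "pull G UNIV (1 * restr UNIV (\<lambda>x. Grass (odd_factor F x) 0))"
  have one: "(1 :: superfun) \<in> sections UNIV" by (simp add: sections_iff)
  note G' = inverse_ofD(1)[OF G]
  have im: "base F ` UNIV = UNIV" using base_image_eq_vimage[OF G] by auto
  have sec: "1 * zeta_coord * restr UNIV (\<lambda>x. Grass (deriv (base F) x) 0) \<in> sections UNIV"
    "1 * restr UNIV (\<lambda>x. Grass (odd_factor F x) 0) \<in> sections UNIV"
    using one base_holomorphic[OF F] odd_factor_holomorphic[OF F]
    by (auto intro!: sections_mult sections_mult_zeta restr_in_sections holomorphic_deriv)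
  have uv: "?u \<in> sections UNIV" "?v \<in> sections UNIV"
    using pull_sections[OF G' open_UNIV] sec by simp_all
  have "germ p (UNIV, Dvf UNIV 1) \<in> stalk D_susy p"
    unfolding stalk_D_susy using one by blast
  then have "germ_push F p (germ p (UNIV, Dvf UNIV 1)) \<in> stalk D_susy ?q"
    using susy unfolding susy_automorphism_def by blast
  also have "germ_push F p (germ p (UNIV, Dvf UNIV 1)) = germ ?q (UNIV, vf UNIV ?u ?v)"
    by (simp only: germ_push_germ[OF F G open_UNIV UNIV_I Dvf_in_TX[OF open_UNIV one]]
        push_Dvf[OF F G open_UNIV one] im)
  finally obtain U s where U: "open U" "?q \<in> U" and s: "s \<in> sections U"
    and eq: "germ ?q (UNIV, vf UNIV ?u ?v) = germ ?q (U, Dvf U s)"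
    unfolding stalk_D_susy by blast
  have "(UNIV, vf UNIV ?u ?v) \<in> germ ?q (U, Dvf U s)"
    unfolding eq[symmetric] using germ_self[OF open_UNIV UNIV_I vf_in_TX[OF open_UNIV uv]] .
  then obtain W where W: "open W" "?q \<in> W" "W \<subseteq> U" 
    and eqW: "vrestr W (Dvf U s) = vrestr W (vf UNIV ?u ?v)"
    unfolding mem_germ_iff by auto
  have "vf W (restr W (s * zeta_coord)) (restr W s) = vf W (restr W ?u) (restr W ?v)"
    using eqW by (simp only: vrestr_vf[OF W(3)] vrestr_vf[OF subset_UNIV])
  \<comment> \<open>A vector field determines its coefficients, so equal germs have equal
    coefficients near \<open>?q\<close>.\<close>
  from vf_eqD[OF this W(1)] have "restr W (s * zeta_coord) = restr W ?u" "restr W s = restr W ?v"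
    using sections_restr[OF sections_mult_zeta[OF s] W(3)] sections_restr[OF s W(3)]
      sections_restr[OF uv(1) subset_UNIV] sections_restr[OF uv(2) subset_UNIV] by auto
  then have "(s * zeta_coord) ?q = ?u ?q" "s ?q = ?v ?q"
    using W(2) by (metis restr_simps)+
  then have "?u ?q = ?v ?q * zeta_coord ?q" by simp
  then have "deriv (base F) p * odd_factor G ?q = odd_factor F p"
    by (simp only: pull_apply[OF G' open_UNIV sec(1)] pull_apply[OF G' open_UNIV sec(2)])
       (simp add: inverse_ofD(2)[OF G] grassmann_eq_iff)
  \<comment> \<open>Multiplying by \<open>odd_factor F p\<close> removes the inverse, since the odd
    factors of \<open>F\<close> at \<open>p\<close> and of \<open>G\<close> at \<open>?q\<close>
    have product 1.\<close>
  then have "deriv (base F) p * (odd_factor F p * odd_factor G ?q) = (odd_factor F p)\<^sup>2"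
    by (simp add: power2_eq_square algebra_simps)
  then show ?thesis using odd_factor_inverse[OF F G, of ?q] by (simp add: inverse_ofD(2)[OF G])
qed

text \<open>The image of the connected plane lies in the finite set of the two roots
  \<open>g 0\<close> and \<open>- g 0\<close>; a nonempty finite connected set is a single
  point.\<close>

lemma continuous_square_eq_const_imp_const:
  fixes g :: "complex \<Rightarrow> complex"
  assumes "continuous_on UNIV g" and "\<And>x. (g x)\<^sup>2 = a"
  shows "\<exists>r. g = (\<lambda>x. r)"
proof -
  have "g x = g 0 \<or> g x = - g 0" for x
    by (simp only: power2_eq_iff[symmetric] assms(2))
  then have "g ` UNIV \<subseteq> {g 0, - g 0}" by auto
  then have "finite (g ` UNIV)" by (rule finite_subset) simp
  moreover have "connected (g ` UNIV)"
    by (rule connected_continuous_image[OF assms(1) connected_UNIV])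
  ultimately obtain r where "g ` UNIV = {r}"
    using connected_finite_iff_sing by (metis UNIV_not_empty image_is_empty)
  then show ?thesis by (intro exI[of _ r]) auto
qed

section \<open>Affine maps preserve the SUSY structure\<close>

lemma inverse_of_affine:
  assumes F: "super_morphism F" and a: "a \<noteq> 0" and r: "r \<noteq> 0"
    and bF: "base F = (\<lambda>x. a * x + b)" and oF: "odd_factor F = (\<lambda>x. r)"
  shows "\<exists>G. inverse_of F G \<and> odd_factor G = (\<lambda>x. inverse r)"
proof -
  \<comment> \<open>The coordinate expression is solved for \<open>z\<close> and \<zeta>.\<close>
  define G where "G = coord_map (\<lambda>x. Grass ((x - b) / a) 0) (\<lambda>x. Grass 0 (inverse r))"
  have G: "super_morphism G"
    unfolding G_def by (rule super_morphism_coord_map)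
      (use a in \<open>auto simp: sections_iff intro!: holomorphic_intros\<close>)
  have bG: "base G = (\<lambda>x. (x - b) / a)" by (simp add: G_def coord_map_def)
  have oG: "odd_factor G = (\<lambda>x. inverse r)"
    by (simp add: G_def odd_factor_def coord_map_def fun_eq_iff)
  \<comment> \<open>Stated for a general pair, so that it serves both orders of composition.\<close>
  have comp: "super_comp H K = super_id"
    if HK: "super_morphism H" "super_morphism K"
      and "\<And>x. base H (base K x) = x" "\<And>x. odd_factor H (base K x) * odd_factor K x = 1" for H K
  proof (intro super_map.equality ext)
    fix U s x
    show "pull (super_comp H K) U s x = pull super_id U s x"
    proof (cases "open U \<and> s \<in> sections U")
      case False
      then have "pull H U s = 0" by (rule super_morphism_off[OF HK(1)])
      with False show ?thesis by (simp only: super_comp_simps super_id_simps pull_0[OF HK(2)] if_False)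
    next
      case True
      then have U: "open U" and s: "s \<in> sections U" by auto
      have "soul (s x) * odd_factor H (base K x) * odd_factor K x = soul (s x)"
        using that(4)[of x] by (simp add: mult.assoc)
      then show ?thesis
        using U s by (simp add: that(3) pull_apply[OF HK(1) U s] grassmann_eq_iff
            pull_apply[OF HK(2) super_morphism_vimage_open[OF HK(1) U] pull_sections[OF HK(1) U s]]
            sections_off)
    qed
  qed (simp_all add: that)
  have "inverse_of F G"
    unfolding inverse_of_def using a r
    by (intro conjI G comp F) (simp_all add: bF bG oF oG)
  with oG show ?thesis by blast
qed

text \<open>The pull-back of \<zeta> under \<open>G\<close> carries the factor
  \<open>inverse r\<close>, which turns the slope \<open>r\<^sup>2\<close> into \<open>r\<close>,
  the same factor as in the \<zeta>-coefficient. Hence the push-forward of \<open>s V\<close> is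
  again a multiple of \<open>V\<close>, namely by \<open>cst r * pull G U s\<close>.\<close>

lemma affine_imp_susy_automorphism:
  assumes F: "super_morphism F" and r: "r \<noteq> 0"
    and bF: "base F = (\<lambda>x. r\<^sup>2 * x + b)" and oF: "odd_factor F = (\<lambda>x. r)"
  shows "susy_automorphism D_susy F"
proof -
  obtain G where G: "inverse_of F G" and oG: "odd_factor G = (\<lambda>x. inverse r)"
    using inverse_of_affine[OF F _ r bF oF] r by auto
  note G' = inverse_ofD(1)[OF G]
  have im: "base F ` A = base G -` A" for A by (rule base_image_eq_vimage[OF G])
  have dF: "deriv (base F) x = r\<^sup>2" for x
    unfolding bF by (rule DERIV_imp_deriv) (auto intro!: derivative_eq_intros)
  have push: "push F (Dvf U s) = Dvf (base F ` U) (cst r * pull G U s)"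
    if U: "open U" and s: "s \<in> sections U" for U s
  proof -
    have c: "restr U (\<lambda>x. Grass c 0) \<in> sections U" for c by (rule restr_in_sections) auto
    have u: "s * zeta_coord * restr U (\<lambda>x. Grass (r\<^sup>2) 0) \<in> sections U"
      and v: "s * restr U (\<lambda>x. Grass r 0) \<in> sections U" 
      using s c by simp_all
    have "pull G U (s * zeta_coord * restr U (\<lambda>x. Grass (r\<^sup>2) 0))
        = cst r * pull G U s * zeta_coord"
      unfolding fun_eq_iff times_fun_apply pull_apply[OF G' U u] pull_apply[OF G' U s]
      using r by (auto simp: grassmann_eq_iff oG power2_eq_square)
    moreover have "pull G U (s * restr U (\<lambda>x. Grass r 0)) = cst r * pull G U s"
      unfolding fun_eq_iff times_fun_apply pull_apply[OF G' U v] pull_apply[OF G' U s]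
      using r by (auto simp: grassmann_eq_iff)
    ultimately show ?thesis by (simp add: push_Dvf[OF F G U s] dF oF)
  qed
  have gp: "germ_push F p (germ p (U, Dvf U s))
      = germ (base F p) (base F ` U, Dvf (base F ` U) (cst r * pull G U s))"
    if "open U" "p \<in> U" "s \<in> sections U" for p U s
    using germ_push_germ[OF F G that(1,2) Dvf_in_TX[OF that(1,3)]] push[OF that(1,3)] by simp
  have "germ_push F p ` stalk D_susy p = stalk D_susy (base F p)" for p
  proof
    show "germ_push F p ` stalk D_susy p \<subseteq> stalk D_susy (base F p)"
    proof
      fix \<gamma> assume "\<gamma> \<in> germ_push F p ` stalk D_susy p"
      then obtain U s where U: "open U" "p \<in> U" "s \<in> sections U"
        and \<gamma>: "\<gamma> = germ (base F p) (base F ` U, Dvf (base F ` U) (cst r * pull G U s))"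
        unfolding stalk_D_susy using gp by auto
      have "open (base F ` U)" "base F p \<in> base F ` U"
        "cst r * pull G U s \<in> sections (base F ` U)"
        using U super_morphism_vimage_open[OF G' U(1)] pull_sections[OF G' U(1,3)]
        by (simp_all add: im inverse_ofD(2)[OF G])
      then show "\<gamma> \<in> stalk D_susy (base F p)" unfolding stalk_D_susy \<gamma> by blast
    qed
    show "stalk D_susy (base F p) \<subseteq> germ_push F p ` stalk D_susy p"
    proof
      fix \<gamma> assume "\<gamma> \<in> stalk D_susy (base F p)"
      then obtain U s where U: "open U" "base F p \<in> U" and s: "s \<in> sections U"
        and \<gamma>: "\<gamma> = germ (base F p) (U, Dvf U s)"
        unfolding stalk_D_susy by blast
      \<comment> \<open>Surjectivity on stalks: \<open>?s\<close> solves
        \<open>cst r * pull G ?U ?s = s\<close>.\<close>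
      let ?U = "base F -` U" and ?s = "cst (inverse r) * pull F U s"
      have U': "open ?U" "p \<in> ?U" using super_morphism_vimage_open[OF F U(1)] U(2) by auto
      have Fs: "pull F U s \<in> sections ?U" by (rule pull_sections[OF F U(1) s])
      then have s': "?s \<in> sections ?U" by simp
      have "base F ` ?U = U" using inverse_ofD(3)[OF G] by (auto simp: im)
      moreover have "cst r * pull G ?U ?s = s"
      proof -
        have "cst r * pull G ?U ?s = cst r * (cst (inverse r) * s)"
          by (simp only: pull_cst[OF G' U'(1) Fs] inverse_ofD(4)[OF G U(1) s])
        also have "\<dots> = s" using r by (simp add: fun_eq_iff grassmann_eq_iff)
        finally show ?thesis .
      qed
      ultimately have "\<gamma> = germ_push F p (germ p (?U, Dvf ?U ?s))"
        by (simp only: gp[OF U' s'] \<gamma>)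
      moreover have "germ p (?U, Dvf ?U ?s) \<in> stalk D_susy p"
        unfolding stalk_D_susy using U' s' by blast
      ultimately show "\<gamma> \<in> germ_push F p ` stalk D_susy p" by blast
    qed
  qed
  then show ?thesis
    unfolding susy_automorphism_def super_automorphism_def using F G by blast
qed

section \<open>The characterization of SUSY automorphisms\<close>

text \<open>The variable \<open>r\<close> ranges over both square roots of \<open>a\<close>, which
  accounts for the sign.\<close>

theorem proposition5p4:
  fixes F :: super_map
  shows "susy_automorphism D_susy F \<longleftrightarrow>
    super_morphism F \<and>
    (\<exists>a b r. a \<noteq> 0 \<and> r\<^sup>2 = a \<and>
      has_coords F (cst a * z_coord + cst b) (cst r * zeta_coord))"
proof
  assume susy: "susy_automorphism D_susy F"
  then obtain G where F: "super_morphism F" and G: "inverse_of F G"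
    unfolding susy_automorphism_def super_automorphism_def by blast
  obtain a b where a: "a \<noteq> 0" and bF: "base F = (\<lambda>z. a * z + b)"
    using inj_entire_imp_affine[OF base_holomorphic[OF F], of "base G"] inverse_ofD[OF G]
      base_holomorphic[OF inverse_ofD(1)[OF G]] holomorphic_on_imp_continuous_on by blast
  have "deriv (base F) x = a" for x
    unfolding bF by (rule DERIV_imp_deriv) (auto intro!: derivative_eq_intros)
  \<comment> \<open>The constant slope makes the odd factor a continuous square root of a
    constant.\<close>
  then have sq: "(odd_factor F x)\<^sup>2 = a" for x
    using susy_automorphism_deriv_base[OF susy F G] by simp
  then obtain r where r: "odd_factor F = (\<lambda>x. r)"
    using continuous_square_eq_const_imp_const odd_factor_holomorphic[OF F]
      holomorphic_on_imp_continuous_on by blast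
  have "has_coords F (cst a * z_coord + cst b) (cst r * zeta_coord)"
    by (simp add: has_coords_iff[OF F] bF r fun_eq_iff grassmann_eq_iff)
  then show "super_morphism F \<and> (\<exists>a b r. a \<noteq> 0 \<and> r\<^sup>2 = a \<and>
      has_coords F (cst a * z_coord + cst b) (cst r * zeta_coord))"
    using F a sq r by auto
next
  assume "super_morphism F \<and> (\<exists>a b r. a \<noteq> 0 \<and> r\<^sup>2 = a \<and>
      has_coords F (cst a * z_coord + cst b) (cst r * zeta_coord))"
  then obtain a b r where F: "super_morphism F" and a: "a \<noteq> 0" "r\<^sup>2 = a"
    and "has_coords F (cst a * z_coord + cst b) (cst r * zeta_coord)" by blast
  then have "base F = (\<lambda>x. r\<^sup>2 * x + b)" "odd_factor F = (\<lambda>x. r)"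
    by (auto simp: has_coords_iff[OF F] fun_eq_iff grassmann_eq_iff)
  moreover have "r \<noteq> 0" using a by auto
  ultimately show "susy_automorphism D_susy F" using affine_imp_susy_automorphism[OF F] by blast
qed

end
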